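(* Let $\theta=\begin{bmatrix}\alpha&\gamma\\ \beta&\delta\end{bmatrix}\in GL_2(\mathbb{Z})$ and $G=(\mathbb{Z}\oplus\mathbb{Z})\rtimes_\theta\mathbb{Z}$. The cohomology groups $H^*(G,\mathbb{Z})$, where $\mathbb{Z}$ is the trivial $\mathbb{Z}G$-module, are given by $$H^0(G,\mathbb{Z})\cong\mathbb{Z},\qquad H^1(G,\mathbb{Z})\cong\mathbb{Z}^{3-\mathrm{rank}(\theta-I)},$$ $$H^2(G,\mathbb{Z})\cong\begin{cases}\mathbb{Z}\oplus\mathbb{Z}\oplus\mathbb{Z},&\text{if }\mathrm{rank}(\theta-I)=0,\\ \mathbb{Z}_{\gcd(\beta,\gamma)}\oplus\mathbb{Z}\oplus\mathbb{Z},&\text{if }\mathrm{rank}(\theta-I)=1\text{ and }\det\theta=1,\\ \mathbb{Z}_{\gcd(\beta,\gamma,2)}\oplus\mathbb{Z},&\text{if }\mathrm{rank}(\theta-I)=1\text{ and }\det\theta=-1,\\ \mathbb{Z}_{c_1}\oplus\mathbb{Z}_{c_2}\oplus\mathbb{Z},&\text{if }\mathrm{rank}(\theta-I)=2\text{ and }\det\theta=1,\\ \mathbb{Z}_{c_1}\oplus\mathbb{Z}_{c_2},&\text{if }\mathrm{rank}(\theta-I)=2\text{ and }\det\theta=-1,\end{cases}$$ $$H^3(G,\mathbb{Z})\cong\begin{cases}\mathbb{Z},&\text{if }\det\theta=1,\\ \mathbb{Z}_2,&\text{if }\det\theta=-1,\end{cases}\qquad H^n(G,\mathbb{Z})\cong0\text{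 if }n\ge4,$$ where, in the rank $2$ cases, $c_1$ and $c_2$ are some positive integers with $c_1\mid c_2$ and $c_1c_2=|\det(\theta-I)|$.
   Context: Write $\mathbb{Z}\oplus\mathbb{Z}=\langle a,b\mid ab=ba\rangle$ and $\mathbb{Z}=\langle t\rangle$; $t$ acts on $\mathbb{Z}\oplus\mathbb{Z}$ by $a\mapsto a^\alpha b^\beta$, $b\mapsto a^\gamma b^\delta$ (this automorphism is also denoted $\theta$). $G=(\mathbb{Z}\oplus\mathbb{Z})\rtimes_\theta\mathbb{Z}=\{(a^mb^n,t^k):m,n,k\in\mathbb{Z}\}$ with product $(g,t^k)(h,t^l)=(g\,\theta^k(h),t^{k+l})$; it is the fundamental group of the torus bundle over $S^1$ determined by $\theta$. $I$ is the $2\times2$ identity matrix, $\mathbb{Z}_n=\mathbb{Z}/n\mathbb{Z}$ (so $\mathbb{Z}_1=0$), and $\gcd(0,n)=|n|$. *)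

theory Defs
  imports
    "HOL-Analysis.Analysis"
    "HOL-Algebra.Bij"
    "HOL-Algebra.FiniteProduct"
    "HOL-Algebra.Product_Groups"
begin

section \<open>Group cohomology\<close>

text \<open>
  The cohomology of a group \<open>G\<close> with coefficients in a \<open>G\<close>-module is defined by the inhomogeneous
  bar cochain complex, i.e. by applying \<open>Hom\<^bsub>\<int>G\<^esub>(_, M)\<close> to the bar resolution of \<open>\<int>\<close>. The module
  consists of an abelian group \<open>M\<close>, written multiplicatively as usual in HOL-Algebra, and an
  action \<open>act\<close> of \<open>G\<close> on it. An \<open>n\<close>-cochain is a function on \<open>n\<close>-tuples of elements of \<open>G\<close>, the
  tuples being represented by lists of length \<open>n\<close>.
\<close>

definition tuples :: "('g, 'x) monoid_scheme \<Rightarrow> nat \<Rightarrow> 'g list set" where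
  "tuples G n = {gs. length gs = n \<and> set gs \<subseteq> carrier G}"

definition cochain_group ::
    "('g, 'x) monoid_scheme \<Rightarrow> ('m, 'y) monoid_scheme \<Rightarrow> nat \<Rightarrow> ('g list \<Rightarrow> 'm) monoid" where
  "cochain_group G M n = product_group (tuples G n) (\<lambda>_. M)"

text \<open>\<open>(g\<^sub>0, \<dots>, g\<^sub>n) \<mapsto> (g\<^sub>0, \<dots>, g\<^sub>i g\<^sub>i\<^sub>+\<^sub>1, \<dots>, g\<^sub>n)\<close>\<close>

definition merge_at :: "('g, 'x) monoid_scheme \<Rightarrow> nat \<Rightarrow> 'g list \<Rightarrow> 'g list" where
  "merge_at G i gs = take i gs @ (gs ! i \<otimes>\<^bsub>G\<^esub> gs ! Suc i) # drop (i + 2) gs"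

text \<open>
  In additive notation,
  \<open>(\<delta>f)(g\<^sub>0, \<dots>, g\<^sub>n) = g\<^sub>0 f(g\<^sub>1, \<dots>, g\<^sub>n) + (\<Sum>i<n. (-1)\<^sup>i\<^sup>+\<^sup>1 f(g\<^sub>0, \<dots>, g\<^sub>i g\<^sub>i\<^sub>+\<^sub>1, \<dots>, g\<^sub>n))
    + (-1)\<^sup>n\<^sup>+\<^sup>1 f(g\<^sub>0, \<dots>, g\<^sub>n\<^sub>-\<^sub>1)\<close>.
\<close>

definition coboundary ::
    "('g, 'x) monoid_scheme \<Rightarrow> ('m, 'y) monoid_scheme \<Rightarrow> ('g \<Rightarrow> 'm \<Rightarrow> 'm) \<Rightarrow> nat
      \<Rightarrow> ('g list \<Rightarrow> 'm) \<Rightarrow> 'g list \<Rightarrow> 'm" where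
  "coboundary G M act n f = (\<lambda>gs \<in> tuples G (Suc n).
     act (hd gs) (f (tl gs))
     \<otimes>\<^bsub>M\<^esub> (\<Otimes>\<^bsub>M\<^esub>i\<in>{..<n}. f (merge_at G i gs) [^]\<^bsub>M\<^esub> ((-1) ^ Suc i :: int))
     \<otimes>\<^bsub>M\<^esub> f (butlast gs) [^]\<^bsub>M\<^esub> ((-1) ^ Suc n :: int))"

definition cocycles ::
    "('g, 'x) monoid_scheme \<Rightarrow> ('m, 'y) monoid_scheme \<Rightarrow> ('g \<Rightarrow> 'm \<Rightarrow> 'm) \<Rightarrow> nat
      \<Rightarrow> ('g list \<Rightarrow> 'm) set" where
  "cocycles G M act n =
     kernel (cochain_group G M n) (cochain_group G M (Suc n)) (coboundary G M act n)"

definition coboundaries ::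
    "('g, 'x) monoid_scheme \<Rightarrow> ('m, 'y) monoid_scheme \<Rightarrow> ('g \<Rightarrow> 'm \<Rightarrow> 'm) \<Rightarrow> nat
      \<Rightarrow> ('g list \<Rightarrow> 'm) set" where
  "coboundaries G M act n = (case n of
       0 \<Rightarrow> {\<one>\<^bsub>cochain_group G M 0\<^esub>}
     | Suc k \<Rightarrow> coboundary G M act k ` carrier (cochain_group G M k))"

definition group_cohomology ::
    "('g, 'x) monoid_scheme \<Rightarrow> ('m, 'y) monoid_scheme \<Rightarrow> ('g \<Rightarrow> 'm \<Rightarrow> 'm) \<Rightarrow> nat
      \<Rightarrow> ('g list \<Rightarrow> 'm) set monoid" where
  "group_cohomology G M act n =
     (cochain_group G M n)\<lparr>carrier := cocycles G M act n\<rparr> Mod coboundaries G M act n"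

abbreviation integral_cohomology ::
    "('g, 'x) monoid_scheme \<Rightarrow> nat \<Rightarrow> ('g list \<Rightarrow> int) set monoid" where
  "integral_cohomology G n \<equiv> group_cohomology G integer_group (\<lambda>_ x. x) n"


section \<open>The group of a torus bundle over the circle\<close>

definition semidirect_product ::
    "('n, 'x) monoid_scheme \<Rightarrow> ('h, 'y) monoid_scheme \<Rightarrow> ('h \<Rightarrow> 'n \<Rightarrow> 'n) \<Rightarrow> ('n \<times> 'h) monoid" where
  "semidirect_product N H \<phi> =
     \<lparr>carrier = carrier N \<times> carrier H,
      monoid.mult = (\<lambda>(x, h) (y, k). (x \<otimes>\<^bsub>N\<^esub> \<phi> h y, h \<otimes>\<^bsub>H\<^esub> k)),
      one = (\<one>\<^bsub>N\<^esub>, \<one>\<^bsub>H\<^esub>)\<rparr>"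

text \<open>
  The pair \<open>(m, n)\<close> stands for \<open>a\<^sup>m b\<^sup>n\<close>; the columns of \<open>\<theta>\<close> are the images of \<open>a\<close> and \<open>b\<close>.
\<close>

definition lattice_aut :: "int^2^2 \<Rightarrow> int \<times> int \<Rightarrow> int \<times> int" where
  "lattice_aut \<theta> = (\<lambda>(m, n). (\<theta>$1$1 * m + \<theta>$1$2 * n, \<theta>$2$1 * m + \<theta>$2$2 * n))"

definition torus_bundle_group :: "int^2^2 \<Rightarrow> ((int \<times> int) \<times> int) monoid" where
  "torus_bundle_group \<theta> =
     semidirect_product (integer_group \<times>\<times> integer_group) integer_group
       (\<lambda>k::int. lattice_aut \<theta> [^]\<^bsub>AutoGroup (integer_group \<times>\<times> integer_group)\<^esub> k)"

end

theory Submission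
  imports Defs
begin

text \<open>
  Let \<open>X\<close> be the \<open>G\<close>-module of all functions \<open>G \<rightarrow> \<int>\<close> under right translation; its higher cohomology
  vanishes. Left translations commute with the action, so the functions invariant under left
  translation by \<open>a\<close>, by \<open>a\<close> and \<open>b\<close>, and by \<open>a\<close>, \<open>b\<close> and \<open>t\<close> form a descending chain of submodules
  \<open>X \<supseteq> X\<^sub>a \<supseteq> X\<^sub>a\<^sub>b \<supseteq> \<int>\<close>, each the kernel of the surjective endomorphism \<open>\<phi> \<mapsto> \<phi> (s \<cdot> _) - \<phi>\<close> of its
  predecessor. Three long exact sequences thus compute \<open>H\<^sup>*(G, \<int>)\<close>. The module \<open>X\<^sub>a\<^sub>b\<close> is coinduced from
  \<open>\<int>\<^sup>2\<close>: its cohomology is \<open>\<int>\<close>, \<open>\<int>\<^sup>2\<close>, \<open>\<int>\<close> in degrees 0, 1, 2, on which \<open>t\<close> acts by 1, \<open>\<theta>\<^sup>T\<close>, \<open>det \<theta>\<close>. Hence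
  \<open>H\<^sup>2(G, \<int>)\<close> is the sum of \<open>coker (\<theta>\<^sup>T - I)\<close> and \<open>ker (det \<theta> - 1)\<close>, and \<open>H\<^sup>3(G, \<int>) = coker (det \<theta> - 1)\<close>.
  With \<open>c\<^sub>1\<close>, \<open>c\<^sub>2\<close> the (possibly zero) elementary divisors of \<open>\<theta>\<^sup>T - I\<close>, the cokernel is
  \<open>\<int>\<^sub>c\<^sub>1 \<oplus> \<int>\<^sub>c\<^sub>2\<close> for every rank, where \<open>\<int>\<^sub>0 = \<int>\<close>.
\<close>

section \<open>The bar complex with coefficients in invariant functions\<close>

text \<open>The carrier is the whole type, so a tuple of group elements is just a list of the right
  length and no membership conditions arise.\<close>

locale full_monoid = monoid G for G (structure) +
  assumes carrier_UNIV [simp]: "carrier G = UNIV"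
begin

lemma assoc: "(x \<otimes> y) \<otimes> z = x \<otimes> (y \<otimes> z)"
  by (simp add: m_assoc)

text \<open>The terms of the coboundary of \<open>f\<close> other than the first one, in which \<open>G\<close> acts.\<close>

fun bar_tail :: "('a list \<Rightarrow> int) \<Rightarrow> 'a list \<Rightarrow> int" where
  "bar_tail f [] = 0"
| "bar_tail f [g] = - f []"
| "bar_tail f (g # h # gs) = - f ((g \<otimes> h) # gs) - bar_tail (\<lambda>s. f (g # s)) (h # gs)"

lemma bar_tail_cong:
  "(\<And>s. Suc (length s) = length gs \<Longrightarrow> f s = f' s) \<Longrightarrow> bar_tail f gs = bar_tail f' gs"
  by (induction f gs arbitrary: f' rule: bar_tail.induct) auto

lemma bar_tail_add: "bar_tail (\<lambda>s. f s + f' s) gs = bar_tail f gs + bar_tail f' gs"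
  by (induction f gs arbitrary: f' rule: bar_tail.induct) auto

lemma bar_tail_diff: "bar_tail (\<lambda>s. f s - f' s) gs = bar_tail f gs - bar_tail f' gs"
  by (induction f gs arbitrary: f' rule: bar_tail.induct) auto

lemma bar_tail_scale: "bar_tail (\<lambda>s. c * f s) gs = c * bar_tail f gs"
  by (induction f gs rule: bar_tail.induct) (auto simp: algebra_simps)

text \<open>Ties the recursion to the alternating sum in \<open>coboundary\<close>: freezing the
  first entry moves every merge position up by one, and this shift of index is the sign in front of
  the recursive call.\<close>

lemma bar_tail_eq_sum:
  "length gs = Suc n \<Longrightarrow>
    bar_tail f gs = (\<Sum>i<n. (-1) ^ Suc i * f (merge_at G i gs)) + (-1) ^ Suc n * f (butlast gs)"
proof (induction f gs arbitrary: n rule: bar_tail.induct)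
  case (3 f g h gs)
  then obtain m where n: "n = Suc m" by (cases n) auto
  have "bar_tail (\<lambda>s. f (g # s)) (h # gs)
      = (\<Sum>i<m. (-1) ^ Suc i * f (g # merge_at G i (h # gs))) + (-1) ^ Suc m * f (g # butlast (h # gs))"
    using 3 n by auto
  moreover have "g # merge_at G i (h # gs) = merge_at G (Suc i) (g # h # gs)" for i
    by (simp add: merge_at_def)
  moreover have "merge_at G 0 (g # h # gs) = (g \<otimes> h) # gs"
    by (simp add: merge_at_def)
  ultimately show ?case
    by (simp add: n sum.lessThan_Suc_shift sum_negf del: sum.lessThan_Suc)
qed auto

text \<open>Expanding the inner tail once splits off a tail in which \<open>g\<close> is multiplied
  into the next entry, which by associativity cancels the first merge term of the outer tail. What
  is left is the double tail with \<open>g\<close> frozen in front, zero by induction.\<close>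

lemma bar_tail_bar_tail: "length gs \<ge> 2 \<Longrightarrow> bar_tail (bar_tail f) gs = 0"
proof (induction f gs rule: bar_tail.induct)
  case (3 f g h gs)
  show ?case
  proof (cases gs)
    case (Cons k ks)
    have "bar_tail (\<lambda>s. bar_tail f (g # s)) (h # gs)
        = bar_tail (\<lambda>s. (- f ((g \<otimes> hd s) # tl s)) - bar_tail (\<lambda>s. f (g # s)) s) (h # gs)"
    proof (rule bar_tail_cong)
      fix s :: "'a list" assume "Suc (length s) = length (h # gs)"
      then obtain u us where "s = u # us" using Cons by (cases s) auto
      then show "bar_tail f (g # s) = - f ((g \<otimes> hd s) # tl s) - bar_tail (\<lambda>s. f (g # s)) s"
        by simp
    qed
    also have "\<dots> = bar_tail (\<lambda>s. (-1) * f ((g \<otimes> hd s) # tl s)) (h # gs)"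
      using 3 Cons by (subst bar_tail_diff) simp
    also have "\<dots> = - bar_tail f ((g \<otimes> h) # gs)"
      by (subst bar_tail_scale) (simp add: Cons assoc)
    finally show ?thesis by simp
  qed simp
qed auto

text \<open>
  A function \<open>\<phi>\<close> on \<open>G\<close> is acted upon by \<open>(g \<cdot> \<phi>) x = \<phi> (x g)\<close>; an \<open>n\<close>-cochain \<open>F\<close> with values in such
  functions is written \<open>F gs x\<close>, and only its values on lists of length \<open>n\<close> matter.
\<close>

definition cobd :: "('a list \<Rightarrow> 'a \<Rightarrow> int) \<Rightarrow> 'a list \<Rightarrow> 'a \<Rightarrow> int" where
  "cobd F gs x = F (tl gs) (x \<otimes> hd gs) + bar_tail (\<lambda>s. F s x) gs"

lemma cobd_cong:
  assumes "\<And>s. Suc (length s) = length gs \<Longrightarrow> F s = F' s" and "gs \<noteq> []"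
  shows "cobd F gs = cobd F' gs"
proof
  fix x
  have "bar_tail (\<lambda>s. F s x) gs = bar_tail (\<lambda>s. F' s x) gs"
    by (rule bar_tail_cong) (simp add: assms(1))
  moreover have "F (tl gs) = F' (tl gs)"
    using assms by (cases gs) auto
  ultimately show "cobd F gs x = cobd F' gs x" by (simp add: cobd_def)
qed

lemma cobd_add: "cobd (\<lambda>s x. F s x + F' s x) gs x = cobd F gs x + cobd F' gs x"
  by (simp add: cobd_def bar_tail_add)

lemma cobd_diff: "cobd (\<lambda>s x. F s x - F' s x) gs x = cobd F gs x - cobd F' gs x"
  by (simp add: cobd_def bar_tail_diff)

lemma cobd_scale: "cobd (\<lambda>s x. c * F s x) gs x = c * cobd F gs x"
  by (simp add: cobd_def bar_tail_scale algebra_simps)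

lemma cobd_zero: "cobd (\<lambda>_ _. 0) gs x = 0"
  using cobd_scale[of 0 "\<lambda>_ _. 0"] by simp

text \<open>The double tail vanishes by \<open>bar_tail_bar_tail\<close>. The terms containing a
  right translation cancel in pairs, since translating by \<open>g\<close> and then by
  \<open>h\<close> is translating by their product.\<close>

lemma cobd_cobd:
  assumes "length gs \<ge> 2"
  shows "cobd (cobd F) gs x = 0"
proof -
  obtain g h r where gs: "gs = g # h # r"
    using assms by (metis Suc_le_length_iff numeral_2_eq_2)
  have "bar_tail (\<lambda>s. cobd F s x) gs
      = bar_tail (\<lambda>s. F (tl s) (x \<otimes> hd s)) gs + bar_tail (bar_tail (\<lambda>s. F s x)) gs"
    by (simp add: cobd_def bar_tail_add)
  also have "\<dots> = - F r (x \<otimes> (g \<otimes> h)) - bar_tail (\<lambda>s. F s (x \<otimes> g)) (h # r)"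
    using bar_tail_bar_tail[OF assms] by (simp add: gs)
  finally show ?thesis by (simp add: cobd_def gs assoc)
qed

text \<open>
  The submodules \<open>Inv S\<close> of functions invariant under left translation by the elements of \<open>S\<close>
  interpolate between all functions (\<open>S = {}\<close>), whose cohomology vanishes, and the constants.
\<close>

definition Inv :: "'a set \<Rightarrow> ('a \<Rightarrow> int) set" where
  "Inv S = {\<phi>. \<forall>s\<in>S. \<forall>x. \<phi> (s \<otimes> x) = \<phi> x}"

definition cochain :: "'a set \<Rightarrow> nat \<Rightarrow> ('a list \<Rightarrow> 'a \<Rightarrow> int) \<Rightarrow> bool" where
  "cochain S n F \<longleftrightarrow> (\<forall>gs. length gs = n \<longrightarrow> F gs \<in> Inv S)"

definition cocycle :: "'a set \<Rightarrow> nat \<Rightarrow> ('a list \<Rightarrow> 'a \<Rightarrow> int) \<Rightarrow> bool" where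
  "cocycle S n F \<longleftrightarrow> cochain S n F \<and> (\<forall>gs x. length gs = Suc n \<longrightarrow> cobd F gs x = 0)"

definition cobounds :: "'a set \<Rightarrow> nat \<Rightarrow> ('a list \<Rightarrow> 'a \<Rightarrow> int) \<Rightarrow> ('a list \<Rightarrow> 'a \<Rightarrow> int) \<Rightarrow> bool" where
  "cobounds S n h F \<longleftrightarrow> cochain S n h \<and> (\<forall>gs. length gs = Suc n \<longrightarrow> F gs = cobd h gs)"

definition is_coboundary :: "'a set \<Rightarrow> nat \<Rightarrow> ('a list \<Rightarrow> 'a \<Rightarrow> int) \<Rightarrow> bool" where
  "is_coboundary S n F \<longleftrightarrow>
    (case n of 0 \<Rightarrow> F [] = (\<lambda>_. 0) | Suc m \<Rightarrow> \<exists>h. cobounds S m h F)"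

section \<open>Closure properties of invariant functions, cochains, cocycles and
  coboundaries\<close>

lemma is_coboundary_0: "is_coboundary S 0 F \<longleftrightarrow> F [] = (\<lambda>_. 0)"
  and is_coboundary_Suc: "is_coboundary S (Suc m) F \<longleftrightarrow> (\<exists>h. cobounds S m h F)"
  by (simp_all add: is_coboundary_def)

lemma Inv_add: "\<phi> \<in> Inv S \<Longrightarrow> \<psi> \<in> Inv S \<Longrightarrow> (\<lambda>x. \<phi> x + \<psi> x) \<in> Inv S"
  and Inv_diff: "\<phi> \<in> Inv S \<Longrightarrow> \<psi> \<in> Inv S \<Longrightarrow> (\<lambda>x. \<phi> x - \<psi> x) \<in> Inv S"
  and Inv_scale: "\<phi> \<in> Inv S \<Longrightarrow> (\<lambda>x. c * \<phi> x) \<in> Inv S"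
  and Inv_zero: "(\<lambda>x. 0) \<in> Inv S"
  and Inv_mono: "S \<subseteq> S' \<Longrightarrow> \<phi> \<in> Inv S' \<Longrightarrow> \<phi> \<in> Inv S"
  and Inv_empty: "\<phi> \<in> Inv {}"
  by (auto simp: Inv_def)

lemma Inv_right_translate: "\<phi> \<in> Inv S \<Longrightarrow> (\<lambda>x. \<phi> (x \<otimes> g)) \<in> Inv S"
  by (auto simp: Inv_def assoc)

lemma cochain_add: "cochain S n F \<Longrightarrow> cochain S n F' \<Longrightarrow> cochain S n (\<lambda>s x. F s x + F' s x)"
  and cochain_diff: "cochain S n F \<Longrightarrow> cochain S n F' \<Longrightarrow> cochain S n (\<lambda>s x. F s x - F' s x)"
  and cochain_scale: "cochain S n F \<Longrightarrow> cochain S n (\<lambda>s x. c * F s x)"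
  and cochain_mono: "S \<subseteq> S' \<Longrightarrow> cochain S' n F \<Longrightarrow> cochain S n F"
  by (auto simp: cochain_def intro: Inv_add Inv_diff Inv_scale Inv_mono)

lemma cocycle_add: "cocycle S n F \<Longrightarrow> cocycle S n F' \<Longrightarrow> cocycle S n (\<lambda>s x. F s x + F' s x)"
  and cocycle_diff: "cocycle S n F \<Longrightarrow> cocycle S n F' \<Longrightarrow> cocycle S n (\<lambda>s x. F s x - F' s x)"
  and cocycle_scale: "cocycle S n F \<Longrightarrow> cocycle S n (\<lambda>s x. c * F s x)"
  and cocycle_mono: "S \<subseteq> S' \<Longrightarrow> cocycle S' n F \<Longrightarrow> cocycle S n F"
  by (auto simp: cocycle_def cobd_add cobd_diff cobd_scale
      intro: cochain_add cochain_diff cochain_scale cochain_mono)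

lemma cocycle_zero: "cocycle S n (\<lambda>_ _. 0)"
  by (simp add: cocycle_def cochain_def Inv_zero cobd_zero)

lemma cocycle_cong:
  assumes "cocycle S n F" and "\<And>gs. length gs = n \<Longrightarrow> F' gs = F gs"
  shows "cocycle S n F'"
  unfolding cocycle_def
proof (intro conjI allI impI)
  show "cochain S n F'" using assms by (simp add: cocycle_def cochain_def)
  fix gs :: "'a list" and x assume len: "length gs = Suc n"
  then have "cobd F' gs = cobd F gs"
    by (intro cobd_cong) (auto simp: assms(2))
  then show "cobd F' gs x = 0" using assms(1) len by (simp add: cocycle_def)
qed

lemma Inv_bar_tail:
  "(\<And>s. Suc (length s) = length gs \<Longrightarrow> F s \<in> Inv S) \<Longrightarrow> (\<lambda>x. bar_tail (\<lambda>s. F s x) gs) \<in> Inv S"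
  by (auto simp: Inv_def intro!: bar_tail_cong)

lemma cochain_cobd:
  assumes "cochain S n F"
  shows "cochain S (Suc n) (cobd F)"
  unfolding cochain_def
proof (intro allI impI)
  fix gs :: "'a list" assume "length gs = Suc n"
  then show "cobd F gs \<in> Inv S"
    using assms unfolding cobd_def
    by (intro Inv_add Inv_right_translate Inv_bar_tail) (auto simp: cochain_def)
qed

lemma cocycle_cobd: "cochain S n F \<Longrightarrow> cocycle S (Suc n) (cobd F)"
  by (simp add: cocycle_def cochain_cobd cobd_cobd)

lemma cobounds_diff:
  "cobounds S n h F \<Longrightarrow> cobounds S n h' F' \<Longrightarrow>
    cobounds S n (\<lambda>s x. h s x - h' s x) (\<lambda>s x. F s x - F' s x)"
  by (auto simp: cobounds_def cochain_diff cobd_diff)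

lemma cobounds_cong:
  "cobounds S n h F \<Longrightarrow> (\<And>gs. length gs = Suc n \<Longrightarrow> F' gs = F gs) \<Longrightarrow> cobounds S n h F'"
  by (simp add: cobounds_def)

lemma cobounds_zero:
  assumes "cobounds S n h F" and "\<And>gs. length gs = Suc n \<Longrightarrow> F gs = (\<lambda>_. 0)"
  shows "cocycle S n h"
proof -
  have "cobd h gs x = 0" if "length gs = Suc n" for gs x
  proof -
    have "F gs = cobd h gs" using assms(1) that by (auto simp: cobounds_def)
    then show ?thesis using assms(2)[OF that] by metis
  qed
  then show ?thesis using assms(1) by (simp add: cobounds_def cocycle_def)
qed

lemma cobounds_mono: "S \<subseteq> S' \<Longrightarrow> cobounds S' n h F \<Longrightarrow> cobounds S n h F"
  by (auto simp: cobounds_def intro: cochain_mono)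

lemma is_coboundary_mono: "S \<subseteq> S' \<Longrightarrow> is_coboundary S' n F \<Longrightarrow> is_coboundary S n F"
  by (auto simp: is_coboundary_def intro: cobounds_mono split: nat.splits)

lemma is_coboundary_cong:
  "is_coboundary S n F \<Longrightarrow> (\<And>gs. length gs = n \<Longrightarrow> F' gs = F gs) \<Longrightarrow> is_coboundary S n F'"
  by (auto simp: is_coboundary_def intro: cobounds_cong split: nat.splits)

section \<open>Low degrees, and the vanishing cohomology of the module of all functions\<close>

lemma cocycle_0_const:
  assumes "cocycle S 0 F"
  shows "F [] x = F [] \<one>"
proof -
  have "cobd F [x] \<one> = 0" using assms unfolding cocycle_def by simp
  then show ?thesis by (simp add: cobd_def)
qed

text \<open>At the identity, right translation by \<open>s\<close> agrees with left translation by
  \<open>s\<close>, under which a primitive is invariant. The value \<open>F [s] \<one>\<close> is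
  thus the obstruction that reappears in \<open>coboundary_1_step\<close>.\<close>

lemma coboundary_1_eval:
  assumes "is_coboundary S (Suc 0) F" and "s \<in> S"
  shows "F [s] \<one> = 0"
proof -
  obtain h where "h [] \<in> Inv S" and "F [s] = cobd h [s]"
    using assms(1) by (auto simp: is_coboundary_Suc cobounds_def cochain_def)
  moreover from this(1) have "h [] (s \<otimes> \<one>) = h [] \<one>"
    using assms(2) unfolding Inv_def by blast
  ultimately show ?thesis by (simp add: cobd_def)
qed

text \<open>The contracting homotopy of the bar complex: move the evaluation point \<open>x\<close>
  to the front of the list and evaluate at the identity. The cocycle condition for
  \<open>x # gs\<close> at the identity is then exactly the claim.\<close>

lemma coboundary_of_free:
  assumes "cocycle {} (Suc m) F"
  shows "is_coboundary {} (Suc m) F"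
  unfolding is_coboundary_Suc cobounds_def
proof (intro exI conjI allI impI ext)
  let ?h = "\<lambda>gs x. F (x # gs) \<one>"
  show "cochain {} m ?h" by (simp add: cochain_def Inv_empty)
  fix gs :: "'a list" and x assume "length gs = Suc m"
  then obtain g r where gs: "gs = g # r" and "length (x # gs) = Suc (Suc m)"
    by (cases gs) auto
  then have "cobd F (x # gs) \<one> = 0" using assms unfolding cocycle_def by blast
  then show "F gs x = cobd ?h gs x"
    by (simp add: cobd_def gs)
qed

definition \<Delta> :: "'a \<Rightarrow> ('a list \<Rightarrow> 'a \<Rightarrow> int) \<Rightarrow> 'a list \<Rightarrow> 'a \<Rightarrow> int" where
  "\<Delta> s F gs x = F gs (s \<otimes> x) - F gs x"

text \<open>Left translations commute with the right translations by which the group acts, so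
  \<open>\<Delta> s\<close> is a cochain map.\<close>

lemma cobd_\<Delta>: "cobd (\<Delta> s F) gs x = cobd F gs (s \<otimes> x) - cobd F gs x"
  by (simp add: \<Delta>_def cobd_def bar_tail_diff assoc)

lemma \<Delta>_diff: "\<Delta> s (\<lambda>gs x. F gs x - F' gs x) gs x = \<Delta> s F gs x - \<Delta> s F' gs x"
  by (simp add: \<Delta>_def)

lemma Inv_insert_iff: "\<phi> \<in> Inv (insert s S) \<longleftrightarrow> \<phi> \<in> Inv S \<and> (\<forall>x. \<phi> (s \<otimes> x) - \<phi> x = 0)"
  by (auto simp: Inv_def)

lemma cochain_insert_iff:
  "cochain (insert s S) n F \<longleftrightarrow> cochain S n F \<and> (\<forall>gs x. length gs = n \<longrightarrow> \<Delta> s F gs x = 0)"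
  by (auto simp: cochain_def Inv_insert_iff \<Delta>_def)

end

text \<open>
  The assumptions make \<open>0 \<longrightarrow> Inv (insert s S) \<longrightarrow> Inv S \<longrightarrow> Inv S \<longrightarrow> 0\<close> exact, the first map being
  the inclusion and the second \<open>\<Delta> s\<close>.
\<close>

locale exact_step = full_monoid +
  fixes S :: "'a set" and s :: 'a
  assumes stable: "\<phi> \<in> Inv S \<Longrightarrow> (\<lambda>x. \<phi> (s \<otimes> x)) \<in> Inv S"
    and onto: "\<phi> \<in> Inv S \<Longrightarrow> \<exists>\<psi>\<in>Inv S. \<forall>x. \<psi> (s \<otimes> x) - \<psi> x = \<phi> x"
begin

section \<open>The long exact sequence of one step, expressed by cochains and primitives\<close>

lemma cochain_\<Delta>: "cochain S n F \<Longrightarrow> cochain S n (\<Delta> s F)"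
  unfolding cochain_def \<Delta>_def using Inv_diff[OF stable] by blast

lemma cocycle_\<Delta>: "cocycle S n F \<Longrightarrow> cocycle S n (\<Delta> s F)"
  by (simp add: cocycle_def cochain_\<Delta> cobd_\<Delta>)

lemma cobounds_\<Delta>: "cobounds S n h F \<Longrightarrow> cobounds S n (\<Delta> s h) (\<Delta> s F)"
  by (auto simp: cobounds_def cochain_\<Delta> cobd_\<Delta> \<Delta>_def)

lemma is_coboundary_\<Delta>: "is_coboundary S n F \<Longrightarrow> is_coboundary S n (\<Delta> s F)"
  by (auto simp: is_coboundary_def \<Delta>_def dest: cobounds_\<Delta> split: nat.splits)

lemma \<Delta>_onto:
  assumes "cochain S n F"
  obtains h where "cochain S n h" "\<And>gs. length gs = n \<Longrightarrow> \<Delta> s h gs = F gs"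
proof -
  have "\<forall>gs. \<exists>\<psi>. length gs = n \<longrightarrow> \<psi> \<in> Inv S \<and> (\<forall>x. \<psi> (s \<otimes> x) - \<psi> x = F gs x)"
    using onto assms by (metis cochain_def)
  then obtain h where "\<forall>gs. length gs = n \<longrightarrow> h gs \<in> Inv S \<and> (\<forall>x. h gs (s \<otimes> x) - h gs x = F gs x)"
    by metis
  then show ?thesis
    using that[of h] by (auto simp: cochain_def \<Delta>_def fun_eq_iff)
qed

text \<open>\<open>\<Delta> s\<close> commutes with \<open>cobd\<close> and kills \<open>F\<close>.
  The class of \<open>\<Delta> s h\<close> is a preimage of the class of \<open>F\<close> under the
  connecting map.\<close>

lemma \<Delta>_primitive_cocycle:
  assumes "cocycle (insert s S) (Suc m) F" and "cobounds S m h F"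
  shows "cocycle S m (\<Delta> s h)"
proof -
  have "cobd (\<Delta> s h) gs x = 0" if "length gs = Suc m" for gs x
    using assms that unfolding cobounds_def cocycle_def cochain_insert_iff cobd_\<Delta>
    by (metis \<Delta>_def)
  then show ?thesis
    using assms by (simp add: cocycle_def cobounds_def cochain_\<Delta>)
qed

text \<open>The connecting map kills every class of the form \<open>\<Delta> s z\<close>.
  Subtracting from \<open>h\<close> the cocycle \<open>z\<close> and a further cocycle
  \<open>k\<close> that accounts for the remaining difference leaves a primitive of \<open>F\<close>
  that is invariant under \<open>s\<close>.\<close>

lemma coboundary_if_primitive:
  assumes "cobounds S m h F" and z: "cocycle S m z"
    and "is_coboundary S m (\<lambda>gs x. \<Delta> s h gs x - \<Delta> s z gs x)"
  shows "is_coboundary (insert s S) (Suc m) F"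
proof -
  \<comment> \<open>In degree 0 the difference is already zero and \<open>k = 0\<close> works.
    Otherwise a primitive of the difference is lifted along \<open>\<Delta> s\<close>, and
    \<open>k\<close> is the coboundary of the lift.\<close>
  obtain k where k: "cochain S m k" "\<And>gs x. length gs = Suc m \<Longrightarrow> cobd k gs x = 0"
    "\<And>gs x. length gs = m \<Longrightarrow> \<Delta> s k gs x = \<Delta> s h gs x - \<Delta> s z gs x"
  proof (cases m)
    case 0
    then show ?thesis
      using that[of "\<lambda>_ _. 0"] assms(3)
      by (simp add: cobd_zero is_coboundary_0 cochain_def Inv_zero \<Delta>_def fun_eq_iff)
  next
    case (Suc l)
    then obtain k0 where "cobounds S l k0 (\<lambda>gs x. \<Delta> s h gs x - \<Delta> s z gs x)"
      using assms(3) by (auto simp: is_coboundary_Suc)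
    then have k0: "cochain S l k0"
      "\<And>gs. length gs = m \<Longrightarrow> (\<lambda>x. \<Delta> s h gs x - \<Delta> s z gs x) = cobd k0 gs"
      by (auto simp: cobounds_def Suc)
    obtain k1 where k1: "cochain S l k1" "\<And>gs. length gs = l \<Longrightarrow> \<Delta> s k1 gs = k0 gs"
      using \<Delta>_onto[OF k0(1)] by metis
    have "\<Delta> s (cobd k1) gs x = \<Delta> s h gs x - \<Delta> s z gs x" if "length gs = m" for gs x
    proof -
      have "\<Delta> s (cobd k1) gs x = cobd (\<Delta> s k1) gs x" by (simp add: cobd_\<Delta>) (simp add: \<Delta>_def)
      also have "\<dots> = cobd k0 gs x"
        using that Suc by (intro fun_cong[OF cobd_cong]) (auto simp: k1)
      finally show ?thesis using k0(2)[OF that] by (metis (no_types))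
    qed
    then show ?thesis
      using that[of "cobd k1"] cochain_cobd[OF k1(1)] Suc by (simp add: cobd_cobd)
  qed
  let ?h = "\<lambda>gs x. (h gs x - z gs x) - k gs x"
  have "cochain (insert s S) m ?h"
    using assms k unfolding cochain_insert_iff
    by (auto simp: cobounds_def cocycle_def cochain_diff \<Delta>_diff)
  then have "cobounds (insert s S) m ?h F"
    using assms(1) k(2) z by (auto simp: cobounds_def cocycle_def cobd_diff)
  then show ?thesis by (auto simp: is_coboundary_Suc)
qed

lemma coboundary_if_primitive_coboundary:
  assumes "cobounds S m h F" and "is_coboundary S m (\<Delta> s h)"
  shows "is_coboundary (insert s S) (Suc m) F"
  using assms(1) cocycle_zero
proof (rule coboundary_if_primitive)
  show "is_coboundary S m (\<lambda>gs x. \<Delta> s h gs x - \<Delta> s (\<lambda>_ _. 0) gs x)"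
    using assms(2) by (rule is_coboundary_cong) (simp add: \<Delta>_def fun_eq_iff)
qed

text \<open>Take \<open>z\<close> to be the difference of \<open>h\<close> and an
  \<open>s\<close>-invariant primitive: two primitives of \<open>F\<close> differ by a cocycle, and
  \<open>\<Delta> s\<close> does not see the invariant one.\<close>

lemma primitive_if_coboundary:
  assumes "cobounds S m h F" and "is_coboundary (insert s S) (Suc m) F"
  obtains z where "cocycle S m z" "\<And>gs. length gs = m \<Longrightarrow> \<Delta> s h gs = \<Delta> s z gs"
proof -
  obtain h' where h': "cobounds (insert s S) m h' F"
    using assms(2) by (auto simp: is_coboundary_Suc)
  have "cobounds S m (\<lambda>gs x. h gs x - h' gs x) (\<lambda>gs x. F gs x - F gs x)"
    using assms(1) cobounds_mono[OF subset_insertI h'] by (rule cobounds_diff)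
  then have "cocycle S m (\<lambda>gs x. h gs x - h' gs x)"
    by (rule cobounds_zero) simp
  moreover have "\<Delta> s h gs = \<Delta> s (\<lambda>gs x. h gs x - h' gs x) gs" if "length gs = m" for gs
    using h' that by (auto simp: cobounds_def cochain_insert_iff \<Delta>_diff)
  ultimately show ?thesis using that by blast
qed

text \<open>The connecting map on cochains: lift \<open>z\<close> along \<open>\<Delta> s\<close>
  and apply \<open>cobd\<close>. The result is invariant under \<open>s\<close> because
  \<open>\<Delta> s\<close> sends it to \<open>cobd z\<close>, which is zero.\<close>

lemma connecting:
  assumes "cocycle S m z"
  obtains h where "cochain S m h" "\<And>gs. length gs = m \<Longrightarrow> \<Delta> s h gs = z gs"
    "cocycle (insert s S) (Suc m) (cobd h)"
proof -
  obtain h where h: "cochain S m h" "\<And>gs. length gs = m \<Longrightarrow> \<Delta> s h gs = z gs"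
    using \<Delta>_onto assms by (metis cocycle_def)
  have "\<Delta> s (cobd h) gs x = 0" if len: "length gs = Suc m" for gs x
  proof -
    have "\<Delta> s (cobd h) gs x = cobd (\<Delta> s h) gs x" by (simp add: cobd_\<Delta>) (simp add: \<Delta>_def)
    also have "\<dots> = cobd z gs x"
      using len by (intro fun_cong[OF cobd_cong]) (auto simp: h)
    finally show ?thesis using assms len by (simp add: cocycle_def)
  qed
  then show ?thesis
    using that[OF h] cocycle_cobd[OF h(1)] by (simp add: cocycle_def cochain_insert_iff)
qed

text \<open>Exactness at the middle term: a class fixed by \<open>s\<close> has a representative
  fixed by \<open>s\<close>. It is found by lifting a primitive of \<open>\<Delta> s z\<close> along
  \<open>\<Delta> s\<close> and subtracting the coboundary of the lift.\<close>

lemma invariant_class_lifts: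
  assumes z: "cocycle S (Suc m) z" and "is_coboundary S (Suc m) (\<Delta> s z)"
  obtains z' where "cocycle (insert s S) (Suc m) z'"
    "is_coboundary S (Suc m) (\<lambda>gs x. z gs x - z' gs x)"
proof -
  obtain k where k: "cobounds S m k (\<Delta> s z)"
    using assms(2) by (auto simp: is_coboundary_Suc)
  obtain k' where k': "cochain S m k'" "\<And>gs. length gs = m \<Longrightarrow> \<Delta> s k' gs = k gs"
    using \<Delta>_onto k by (metis cobounds_def)
  let ?z = "\<lambda>gs x. z gs x - cobd k' gs x"
  have "\<Delta> s ?z gs x = 0" if len: "length gs = Suc m" for gs x
  proof -
    have "\<Delta> s (cobd k') gs x = cobd (\<Delta> s k') gs x" by (simp add: cobd_\<Delta>) (simp add: \<Delta>_def)
    also have "\<dots> = cobd k gs x"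
      using len by (intro fun_cong[OF cobd_cong]) (auto simp: k')
    also have "\<dots> = \<Delta> s z gs x" using k len by (simp add: cobounds_def)
    finally show ?thesis by (simp add: \<Delta>_diff)
  qed
  moreover have "cocycle S (Suc m) ?z"
    by (intro cocycle_diff z cocycle_cobd k')
  ultimately have "cocycle (insert s S) (Suc m) ?z"
    by (simp add: cocycle_def cochain_insert_iff)
  moreover have "is_coboundary S (Suc m) (\<lambda>gs x. z gs x - ?z gs x)"
    using k'(1) by (auto simp: is_coboundary_Suc cobounds_def)
  ultimately show ?thesis using that by blast
qed

text \<open>For a primitive \<open>h\<close>, the degree 0 cocycle \<open>\<Delta> s h\<close> is
  invariant under right translations, hence constant, and its value is
  \<open>F [s] \<one>\<close>.\<close>

lemma coboundary_1_step:
  assumes F: "cocycle (insert s S) (Suc 0) F" and "is_coboundary S (Suc 0) F" and "F [s] \<one> = 0"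
  shows "is_coboundary (insert s S) (Suc 0) F"
proof -
  obtain h where h: "cobounds S 0 h F"
    using assms(2) by (auto simp: is_coboundary_Suc)
  have "\<Delta> s h [] x = 0" for x
  proof -
    have "\<Delta> s h [] x = \<Delta> s h [] \<one>"
      by (rule cocycle_0_const[OF \<Delta>_primitive_cocycle[OF F h]])
    also have "\<dots> = cobd h [s] \<one>" by (simp add: \<Delta>_def cobd_def)
    also have "\<dots> = F [s] \<one>" using h by (simp add: cobounds_def)
    finally show ?thesis using assms(3) by simp
  qed
  then have "is_coboundary S 0 (\<Delta> s h)" by (simp add: is_coboundary_0 fun_eq_iff)
  with h show ?thesis by (rule coboundary_if_primitive_coboundary)
qed

text \<open>In the long exact sequence the group in question lies between the cohomology of
  \<open>Inv S\<close> in degrees \<open>m\<close> and \<open>Suc m\<close>, both assumed to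
  vanish.\<close>

lemma coboundary_of_vanishing:
  assumes "\<And>F. cocycle S (Suc m) F \<Longrightarrow> is_coboundary S (Suc m) F"
    and "\<And>F. cocycle S m F \<Longrightarrow> is_coboundary S m F"
    and F: "cocycle (insert s S) (Suc m) F"
  shows "is_coboundary (insert s S) (Suc m) F"
proof -
  obtain h where h: "cobounds S m h F"
    using assms(1) cocycle_mono[OF subset_insertI F] by (auto simp: is_coboundary_Suc)
  have "is_coboundary S m (\<Delta> s h)"
    using assms(2) \<Delta>_primitive_cocycle[OF F h] by blast
  with h show ?thesis by (rule coboundary_if_primitive_coboundary)
qed

end

section \<open>Comparison with integral group cohomology\<close>

lemma finprod_integer_group:
  "finite I \<Longrightarrow> finprod integer_group f I = sum f I"
proof (induction I rule: finite_induct)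
  case empty
  then show ?case
    using comm_monoid.finprod_empty[OF comm_group.axioms(1)[OF abelian_integer_group]] by simp
next
  case (insert i I)
  then show ?case
    using comm_monoid.finprod_insert[OF comm_group.axioms(1)[OF abelian_integer_group], of I i f]
    by simp
qed

section \<open>Constant functions as the trivial module, and criteria for computing its
  cohomology\<close>

context full_monoid
begin

abbreviation (input) const :: "('a list \<Rightarrow> int) \<Rightarrow> 'a list \<Rightarrow> 'a \<Rightarrow> int" where
  "const F \<equiv> \<lambda>gs _. F gs"

abbreviation "C n \<equiv> cochain_group G integer_group n"
abbreviation "D n \<equiv> coboundary G integer_group (\<lambda>_ x. x) n"

lemma Inv_UNIV_iff: "\<phi> \<in> Inv UNIV \<longleftrightarrow> (\<forall>x. \<phi> x = \<phi> \<one>)"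
proof
  assume "\<phi> \<in> Inv UNIV"
  then have "\<phi> (x \<otimes> \<one>) = \<phi> \<one>" for x unfolding Inv_def by blast
  then show "\<forall>x. \<phi> x = \<phi> \<one>" by simp
next
  assume *: "\<forall>x. \<phi> x = \<phi> \<one>"
  show "\<phi> \<in> Inv UNIV"
    unfolding Inv_def
  proof (intro CollectI ballI allI)
    fix s x show "\<phi> (s \<otimes> x) = \<phi> x"
      using *[rule_format, of "s \<otimes> x"] *[rule_format, of x] by (rule trans[OF _ sym])
  qed
qed

lemma cochain_const: "cochain S n (const F)"
  by (simp add: cochain_def Inv_def)

lemma is_coboundary_of_zero:
  assumes "\<And>gs. length gs = n \<Longrightarrow> F gs = (\<lambda>_. 0)"
  shows "is_coboundary S n F"
proof (cases n)
  case 0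
  then show ?thesis using assms by (simp add: is_coboundary_0)
next
  case (Suc m)
  have "cobounds S m (\<lambda>_ _. 0) F"
    using assms Suc by (auto simp: cobounds_def cochain_def Inv_zero cobd_zero)
  then show ?thesis by (auto simp: Suc is_coboundary_Suc)
qed

lemma tuples_G: "tuples G n = {gs. length gs = n}"
  by (simp add: tuples_def)

lemma group_C: "group (C n)"
  by (simp add: cochain_group_def)

lemma carrier_C: "carrier (C n) = extensional (tuples G n)"
  by (simp add: cochain_group_def PiE_def)

lemma mult_C: "f \<otimes>\<^bsub>C n\<^esub> f' = (\<lambda>gs\<in>tuples G n. f gs + f' gs)"
  by (simp add: cochain_group_def)

lemma one_C: "\<one>\<^bsub>C n\<^esub> = (\<lambda>gs\<in>tuples G n. 0)"
  by (simp add: cochain_group_def)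

lemma coboundary_eq: "D n f = (\<lambda>gs\<in>tuples G (Suc n). cobd (const f) gs \<one>)"
proof
  fix gs
  have "f (tl gs) + (\<Sum>i<n. (-1) ^ Suc i * f (merge_at G i gs)) + (-1) ^ Suc n * f (butlast gs)
      = cobd (const f) gs \<one>" if "length gs = Suc n"
    by (simp add: cobd_def bar_tail_eq_sum[OF that])
  then show "D n f gs = (\<lambda>gs\<in>tuples G (Suc n). cobd (const f) gs \<one>) gs"
    by (simp add: coboundary_def finprod_integer_group tuples_G del: power_Suc)
qed

lemma cobd_const: "cobd (const f) gs x = cobd (const f) gs \<one>"
  by (simp add: cobd_def)

lemma coboundary_hom: "D n \<in> hom (C n) (C (Suc n))"
proof (rule homI)
  fix f assume "f \<in> carrier (C n)"
  show "D n f \<in> carrier (C (Suc n))" by (simp add: coboundary_eq carrier_C)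
next
  fix f f' assume "f \<in> carrier (C n)" "f' \<in> carrier (C n)"
  have "cobd (const (f \<otimes>\<^bsub>C n\<^esub> f')) gs \<one> = cobd (const f) gs \<one> + cobd (const f') gs \<one>"
    if "length gs = Suc n" for gs
  proof -
    have "cobd (const (f \<otimes>\<^bsub>C n\<^esub> f')) gs = cobd (\<lambda>gs x. f gs + f' gs) gs"
      using that by (intro cobd_cong) (auto simp: mult_C tuples_G)
    then show ?thesis by (simp add: cobd_add)
  qed
  then show "D n (f \<otimes>\<^bsub>C n\<^esub> f') = D n f \<otimes>\<^bsub>C (Suc n)\<^esub> D n f'"
    by (auto simp: coboundary_eq tuples_G mult_C[of "Suc n"] fun_eq_iff)
qed

lemma cocycles_eq:
  "cocycles G integer_group (\<lambda>_ x. x) n = {f \<in> extensional (tuples G n). cocycle UNIV n (const f)}"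
proof -
  have "D n f = \<one>\<^bsub>C (Suc n)\<^esub> \<longleftrightarrow> cocycle UNIV n (const f)" for f
  proof -
    have "D n f = \<one>\<^bsub>C (Suc n)\<^esub> \<longleftrightarrow> (\<forall>gs. length gs = Suc n \<longrightarrow> cobd (const f) gs \<one> = 0)"
      by (auto simp: coboundary_eq one_C tuples_G fun_eq_iff)
    also have "\<dots> \<longleftrightarrow> cocycle UNIV n (const f)"
      by (auto simp: cocycle_def cochain_const cobd_def)
    finally show ?thesis .
  qed
  then show ?thesis by (simp add: cocycles_def kernel_def carrier_C)
qed

lemma coboundaries_eq:
  "coboundaries G integer_group (\<lambda>_ x. x) n =
    {f \<in> extensional (tuples G n). is_coboundary UNIV n (const f)}"
proof (cases n)
  case 0
  have "f = (\<lambda>gs\<in>{[]}. 0) \<longleftrightarrow> f [] = 0" if "f \<in> extensional {[]}" for f :: "'a list \<Rightarrow> int"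
    using that by (auto simp: extensional_def restrict_def)
  moreover have "tuples G 0 = {[]}" by (auto simp: tuples_G)
  ultimately show ?thesis
    by (auto simp: coboundaries_def 0 one_C is_coboundary_0 fun_eq_iff)
next
  case (Suc m)
  have "(\<exists>h\<in>extensional (tuples G m). f = D m h) \<longleftrightarrow> is_coboundary UNIV n (const f)"
    if f: "f \<in> extensional (tuples G n)" for f
  proof
    assume "\<exists>h\<in>extensional (tuples G m). f = D m h"
    then obtain h where "f = D m h" by blast
    then have "cobounds UNIV m (const h) (const f)"
      by (auto simp: cobounds_def cochain_const coboundary_eq tuples_G intro: cobd_const[symmetric])
    then show "is_coboundary UNIV n (const f)" by (auto simp: is_coboundary_Suc Suc)
  next
    assume "is_coboundary UNIV n (const f)"
    then obtain h where h: "cobounds UNIV m h (const f)" by (auto simp: is_coboundary_Suc Suc)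
    \<comment> \<open>Membership in \<open>Inv UNIV\<close> makes \<open>h gs\<close> a constant
      function for lists of length \<open>m\<close>, so its value at the identity loses nothing; the
      restriction makes the cochain extensional.\<close>
    let ?h = "\<lambda>gs\<in>tuples G m. h gs \<one>"
    have "f gs = cobd (const ?h) gs \<one>" if "length gs = Suc m" for gs
    proof -
      have "(\<lambda>x. f gs) = cobd h gs" using h that by (simp add: cobounds_def)
      also have "\<dots> = cobd (const ?h) gs"
      proof (rule cobd_cong)
        fix s :: "'a list" assume "Suc (length s) = length gs"
        then have "h s \<in> Inv UNIV" using h that by (simp add: cobounds_def cochain_def)
        then show "h s = const ?h s"
          using \<open>Suc (length s) = length gs\<close> that
          by (auto simp: Inv_UNIV_iff tuples_G)
      qed (use that in auto)
      finally show ?thesis by metis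
    qed
    then have "f = D m ?h"
      using f by (intro ext) (simp add: coboundary_eq tuples_G Suc extensional_def restrict_def)
    then show "\<exists>h\<in>extensional (tuples G m). f = D m h" by blast
  qed
  moreover have "D m h \<in> extensional (tuples G n)" for h
    by (simp add: coboundary_eq Suc)
  ultimately show ?thesis
    by (auto simp: coboundaries_def Suc carrier_C)
qed

text \<open>The first isomorphism theorem for \<open>\<epsilon>\<close> on cocycles. As
  \<open>add\<close> refers only to values on lists of length \<open>n\<close>, adding the zero
  cocycle shows that \<open>\<epsilon>\<close> ignores all other values; hence a witness from
  \<open>onto\<close> may be made extensional.\<close>

lemma integral_cohomology_iso:
  assumes A: "group A"
    and add: "\<And>F F' F''. cocycle UNIV n (const F) \<Longrightarrow> cocycle UNIV n (const F') \<Longrightarrow>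
      (\<And>gs. length gs = n \<Longrightarrow> F'' gs = F gs + F' gs) \<Longrightarrow> \<epsilon> F'' = \<epsilon> F \<otimes>\<^bsub>A\<^esub> \<epsilon> F'"
    and closed: "\<And>F. cocycle UNIV n (const F) \<Longrightarrow> \<epsilon> F \<in> carrier A"
    and onto: "\<And>y. y \<in> carrier A \<Longrightarrow> \<exists>F. cocycle UNIV n (const F) \<and> \<epsilon> F = y"
    and ker: "\<And>F. cocycle UNIV n (const F) \<Longrightarrow> \<epsilon> F = \<one>\<^bsub>A\<^esub> \<longleftrightarrow> is_coboundary UNIV n (const F)"
  shows "group (integral_cohomology G n)" and "integral_cohomology G n \<cong> A"
proof -
  let ?Z = "cocycles G integer_group (\<lambda>_ x. x) n"
  let ?ZG = "(C n)\<lparr>carrier := ?Z\<rparr>"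
  interpret C: group "C n" by (rule group_C)
  have "subgroup ?Z (C n)"
    unfolding cocycles_def
    by (intro group_hom.subgroup_kernel group_hom.intro group_hom_axioms.intro
        group_C coboundary_hom)
  then have ZG: "group ?ZG" by (rule C.subgroup_imp_group)
  have "\<epsilon> \<in> hom ?ZG A"
  proof (rule homI)
    fix f assume "f \<in> carrier ?ZG"
    then show "\<epsilon> f \<in> carrier A" using closed by (simp add: cocycles_eq)
  next
    fix f f' assume "f \<in> carrier ?ZG" "f' \<in> carrier ?ZG"
    then show "\<epsilon> (f \<otimes>\<^bsub>?ZG\<^esub> f') = \<epsilon> f \<otimes>\<^bsub>A\<^esub> \<epsilon> f'"
      by (intro add) (auto simp: cocycles_eq mult_C tuples_G)
  qed
  then interpret E: group_hom ?ZG A \<epsilon>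
    by (intro group_hom.intro group_hom_axioms.intro ZG A)
  have "is_coboundary UNIV n (const f) \<Longrightarrow> cocycle UNIV n (const f)" for f
  proof (cases n)
    case 0
    have "cobd (const f) gs x = 0" if "length gs = Suc 0" "f [] = 0" for gs x
      using that by (cases gs) (auto simp: cobd_def)
    then show "is_coboundary UNIV n (const f) \<Longrightarrow> cocycle UNIV n (const f)"
      by (auto simp: 0 is_coboundary_0 cocycle_def cochain_const fun_eq_iff)
  next
    case (Suc m)
    assume "is_coboundary UNIV n (const f)"
    then obtain h where "cochain UNIV m h" "\<And>gs. length gs = Suc m \<Longrightarrow> const f gs = cobd h gs"
      by (auto simp: Suc is_coboundary_Suc cobounds_def)
    then show "cocycle UNIV n (const f)"
      unfolding Suc by (rule_tac cocycle_cong[OF cocycle_cobd])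
  qed
  then have kernel: "kernel ?ZG A \<epsilon> = coboundaries G integer_group (\<lambda>_ x. x) n"
    using ker by (auto simp: kernel_def coboundaries_eq cocycles_eq)
  show "group (integral_cohomology G n)"
    unfolding group_cohomology_def kernel[symmetric]
    by (rule normal.factorgroup_is_group[OF E.normal_kernel])
  have "\<epsilon> ` carrier ?ZG = carrier A"
  proof
    show "carrier A \<subseteq> \<epsilon> ` carrier ?ZG"
    proof
      fix y assume "y \<in> carrier A"
      then obtain F where F: "cocycle UNIV n (const F)" "\<epsilon> F = y" using onto by blast
      let ?F = "\<lambda>gs\<in>tuples G n. F gs"
      have "\<epsilon> ?F = \<epsilon> F \<otimes>\<^bsub>A\<^esub> \<epsilon> (\<lambda>_. 0)" "\<epsilon> F = \<epsilon> F \<otimes>\<^bsub>A\<^esub> \<epsilon> (\<lambda>_. 0)"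
        by (rule add; use F(1) cocycle_zero in \<open>simp add: tuples_G\<close>)+
      moreover have "cocycle UNIV n (const ?F)"
        by (rule cocycle_cong[OF F(1)]) (simp add: tuples_G)
      ultimately show "y \<in> \<epsilon> ` carrier ?ZG"
        using F(2) by (auto simp: cocycles_eq intro!: image_eqI[of _ _ ?F])
    qed
  qed (use E.hom_closed in auto)
  then show "integral_cohomology G n \<cong> A"
    unfolding group_cohomology_def kernel[symmetric] by (rule E.FactGroup_iso)
qed

text \<open>
  The class of \<open>F\<close> may be described by any \<open>v\<close> with \<open>R F v\<close>, such as the invariant
  of an arbitrarily chosen primitive of \<open>F\<close>.
\<close>

lemma integral_cohomology_iso_rel:
  fixes R :: "('a list \<Rightarrow> int) \<Rightarrow> 'v :: ab_group_add \<Rightarrow> bool"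
  assumes A: "group A"
    and \<kappa>_add: "\<And>v w. \<kappa> (v + w) = \<kappa> v \<otimes>\<^bsub>A\<^esub> \<kappa> w"
    and \<kappa>_onto: "range \<kappa> = carrier A"
    and total: "\<And>F. cocycle UNIV n (const F) \<Longrightarrow> \<exists>v. R F v"
    and onto: "\<And>v. \<exists>F. cocycle UNIV n (const F) \<and> R F v"
    and diff: "\<And>F F' v v'. R F v \<Longrightarrow> R F' v' \<Longrightarrow> R (\<lambda>gs. F gs - F' gs) (v - v')"
    and ker: "\<And>F v. cocycle UNIV n (const F) \<Longrightarrow> R F v \<Longrightarrow>
      \<kappa> v = \<one>\<^bsub>A\<^esub> \<longleftrightarrow> is_coboundary UNIV n (const F)"
  shows "integral_cohomology G n \<cong> A"
proof -
  interpret A: group A by (rule A)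
  define \<epsilon> where "\<epsilon> F = \<kappa> (SOME v. R F v)" for F
  have \<kappa>_carrier: "\<kappa> v \<in> carrier A" for v using \<kappa>_onto by blast
  have \<kappa>_sum: "\<kappa> v'' = \<kappa> v \<otimes>\<^bsub>A\<^esub> \<kappa> v'"
    if "cocycle UNIV n (const F)" "cocycle UNIV n (const F')"
      "\<And>gs. length gs = n \<Longrightarrow> F'' gs = F gs + F' gs" "R F v" "R F' v'" "R F'' v''"
    for F F' F'' v v' v''
  proof -
    \<comment> \<open>This cochain vanishes in degree \<open>n\<close>, so it is a coboundary and
      \<open>ker\<close> sends any invariant of it to the identity. That gives additivity and also
      independence of the chosen invariants.\<close>
    let ?E = "\<lambda>gs. F'' gs - F gs - F' gs"
    have zero: "length gs = n \<Longrightarrow> const ?E gs = (\<lambda>_. 0)" for gs using that(3) by simp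
    have "R ?E (v'' - v - v')" by (intro diff that)
    moreover have "cocycle UNIV n (const ?E)"
      by (rule cocycle_cong[OF cocycle_zero]) (use zero in simp)
    ultimately have "\<kappa> (v'' - v - v') = \<one>\<^bsub>A\<^esub>"
      using ker[of ?E "v'' - v - v'"] is_coboundary_of_zero[of n "const ?E" UNIV] zero by simp
    moreover have "\<kappa> v'' = \<kappa> (v'' - v - v') \<otimes>\<^bsub>A\<^esub> (\<kappa> v \<otimes>\<^bsub>A\<^esub> \<kappa> v')"
      by (simp flip: \<kappa>_add)
    ultimately show ?thesis using \<kappa>_carrier by simp
  qed
  have some: "R F (SOME v. R F v)" if "cocycle UNIV n (const F)" for F
    using total[OF that] by (rule someI_ex)
  have sum_cocycle: "cocycle UNIV n (const F'')"
    if "cocycle UNIV n (const F)" "cocycle UNIV n (const F')"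
      "\<And>gs. length gs = n \<Longrightarrow> F'' gs = F gs + F' gs" for F F' F''
    by (rule cocycle_cong[OF cocycle_add[OF that(1,2)]]) (simp add: that(3))
  have zero_cocycle: "cocycle UNIV n (const (\<lambda>_. 0))" by (rule cocycle_zero)
  show ?thesis
  proof (rule integral_cohomology_iso(2)[OF A, of n \<epsilon>])
    fix F F' F''
    assume *: "cocycle UNIV n (const F)" "cocycle UNIV n (const F')"
      "\<And>gs. length gs = n \<Longrightarrow> F'' gs = F gs + F' gs"
    then show "\<epsilon> F'' = \<epsilon> F \<otimes>\<^bsub>A\<^esub> \<epsilon> F'"
      unfolding \<epsilon>_def by (intro \<kappa>_sum[OF *] some sum_cocycle[OF *]) auto
  next
    fix y assume "y \<in> carrier A"
    then have "y \<in> range \<kappa>" using \<kappa>_onto by simp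
    then obtain v where v: "\<kappa> v = y" by blast
    obtain F where F: "cocycle UNIV n (const F)" "R F v" using onto by blast
    have "\<kappa> v \<otimes>\<^bsub>A\<^esub> \<kappa> (SOME v. R (\<lambda>_. 0) v) = \<kappa> (SOME v. R F v)"
      by (rule \<kappa>_sum[OF F(1) zero_cocycle, symmetric])
        (use F some zero_cocycle in auto)
    moreover have "\<kappa> (SOME v. R (\<lambda>_. 0) v) = \<one>\<^bsub>A\<^esub>"
      using ker[OF zero_cocycle some[OF zero_cocycle]]
        is_coboundary_of_zero[of n "const (\<lambda>_. 0)" UNIV] by simp
    ultimately show "\<exists>F. cocycle UNIV n (const F) \<and> \<epsilon> F = y"
      using F(1) v \<kappa>_carrier by (auto simp: \<epsilon>_def)
  next
    fix F assume "cocycle UNIV n (const F)"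
    then show "\<epsilon> F = \<one>\<^bsub>A\<^esub> \<longleftrightarrow> is_coboundary UNIV n (const F)"
      unfolding \<epsilon>_def by (intro ker some)
  qed (simp add: \<epsilon>_def \<kappa>_carrier)
qed

lemma trivial_integral_cohomology:
  assumes "\<And>F. cocycle UNIV n F \<Longrightarrow> is_coboundary UNIV n F"
  shows "trivial_group (integral_cohomology G n)"
proof -
  let ?A = "integer_mod_group 1"
  have *: "group (integral_cohomology G n)" "integral_cohomology G n \<cong> ?A"
    using assms by (intro integral_cohomology_iso[of ?A n "\<lambda>_. 0"];
        auto simp: carrier_integer_mod_group intro: exI[of _ "\<lambda>_. 0"] cocycle_zero)+
  then show ?thesis
    using isomorphic_group_triviality[OF *(2,1) group_integer_mod_group] trivial_integer_mod_group
    by simp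
qed

end

section \<open>The Smith normal form of a two by two matrix\<close>

text \<open>By Bezout \<open>gcd e f\<close> is itself a positive value of the combination, so
  \<open>g\<close> is at most \<open>gcd e f\<close>; conversely \<open>gcd e f\<close> divides
  \<open>g\<close>.\<close>

lemma minimal_combination_dvd:
  fixes e f g :: int
  assumes "g > 0" and g: "e * y1 + f * y2 = g"
    and min: "\<And>z1 z2. e * z1 + f * z2 > 0 \<Longrightarrow> g \<le> e * z1 + f * z2"
  shows "g dvd e \<and> g dvd f"
proof -
  obtain z1 z2 where z: "z1 * e + z2 * f = gcd e f" using bezout_int by blast
  have "gcd e f dvd g" unfolding g[symmetric] by (intro dvd_add dvd_mult2) auto
  moreover have "e \<noteq> 0 \<or> f \<noteq> 0" using assms by auto
  then have "gcd e f > 0" by (simp add: gcd_pos_int)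
  then have "g \<le> gcd e f" using min[of z1 z2] z by (simp add: mult.commute)
  ultimately have "g = gcd e f" using \<open>g > 0\<close> \<open>gcd e f > 0\<close> zdvd_imp_le by fastforce
  then show ?thesis by simp
qed

text \<open>
  The first elementary divisor is the least positive value of the bilinear form of the matrix.
\<close>

lemma smith_diagonalisation:
  fixes p q r s :: int
  obtains u11 u12 u21 u22 v11 v12 v21 v22 c1 c2 :: int
  where "u11 * u22 - u12 * u21 = 1" "v11 * v22 - v12 * v21 = 1" "0 \<le> c1" "c1 dvd c2"
    "u11 * (p * v11 + q * v21) + u12 * (r * v11 + s * v21) = c1"
    "u11 * (p * v12 + q * v22) + u12 * (r * v12 + s * v22) = 0"
    "u21 * (p * v11 + q * v21) + u22 * (r * v11 + s * v21) = 0"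
    "u21 * (p * v12 + q * v22) + u22 * (r * v12 + s * v22) = c2"
proof (cases "p = 0 \<and> q = 0 \<and> r = 0 \<and> s = 0")
  case True
  then show ?thesis using that[of 1 1 0 0 1 1 0 0 0 0] by simp
next
  case False
  define B where "B x1 x2 y1 y2 = x1 * (p * y1 + q * y2) + x2 * (r * y1 + s * y2)" for x1 x2 y1 y2
  define P where "P n \<longleftrightarrow> n > 0 \<and> (\<exists>x1 x2 y1 y2. B x1 x2 y1 y2 = int n)" for n
  have "\<exists>n. P n"
  proof -
    have *: "P (nat \<bar>B x1 x2 y1 y2\<bar>)" if "B x1 x2 y1 y2 \<noteq> 0" for x1 x2 y1 y2
    proof -
      have "B (- x1) (- x2) y1 y2 = - B x1 x2 y1 y2" by (simp add: B_def algebra_simps)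
      then show ?thesis using that unfolding P_def
        by (cases "B x1 x2 y1 y2 > 0") (auto intro: exI[of _ "- x1"] exI[of _ x1])
    qed
    have "B 1 0 1 0 = p" "B 1 0 0 1 = q" "B 0 1 1 0 = r" "B 0 1 0 1 = s" by (simp_all add: B_def)
    then show ?thesis using * False by metis
  qed
  define n where "n = (LEAST n. P n)"
  have "P n" unfolding n_def using \<open>\<exists>n. P n\<close> by (rule LeastI_ex)
  define g where "g = int n"
  obtain x1 x2 y1 y2 where g: "g > 0" "B x1 x2 y1 y2 = g"
    using \<open>P n\<close> by (auto simp: P_def g_def)
  have min: "g \<le> B x1 x2 y1 y2" if "B x1 x2 y1 y2 > 0" for x1 x2 y1 y2
  proof -
    have "P (nat (B x1 x2 y1 y2))" using that unfolding P_def by auto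
    then have "n \<le> nat (B x1 x2 y1 y2)" unfolding n_def by (rule Least_le)
    then show ?thesis using that by (simp add: g_def)
  qed
  \<comment> \<open>With one argument fixed the form is an integer combination in the other, so
    \<open>minimal_combination_dvd\<close> applies on both sides.\<close>
  have row: "B x1 x2 y1 y2 = (x1 * p + x2 * r) * y1 + (x1 * q + x2 * s) * y2"
    and col: "B x1 x2 y1 y2 = (p * y1 + q * y2) * x1 + (r * y1 + s * y2) * x2" for x1 x2 y1 y2
    by (simp_all add: B_def algebra_simps)
  have "g dvd x1 * p + x2 * r \<and> g dvd x1 * q + x2 * s"
    using g(1) g(2)[unfolded row] by (rule minimal_combination_dvd) (use min in \<open>simp add: row\<close>)
  then obtain z1 z2 where z: "x1 * p + x2 * r = g * z1" "x1 * q + x2 * s = g * z2" by (auto elim!: dvdE)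
  have "g dvd p * y1 + q * y2 \<and> g dvd r * y1 + s * y2"
    using g(1) g(2)[unfolded col] by (rule minimal_combination_dvd) (use min in \<open>simp add: col\<close>)
  then obtain w1 w2 where w: "p * y1 + q * y2 = g * w1" "r * y1 + s * y2 = g * w2" by (auto elim!: dvdE)
  have "g * (z1 * y1 + z2 * y2) = B x1 x2 y1 y2"
    unfolding row z by (simp add: algebra_simps)
  moreover have "g * (w1 * x1 + w2 * x2) = B x1 x2 y1 y2"
    unfolding col w by (simp add: algebra_simps)
  ultimately have "g * (z1 * y1 + z2 * y2) = g * 1" "g * (w1 * x1 + w2 * x2) = g * 1"
    using g(2) by simp_all
  then have one: "z1 * y1 + z2 * y2 = 1" "w1 * x1 + w2 * x2 = 1"
    using g(1) unfolding mult_cancel_left by simp_all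
  \<comment> \<open>The vectors \<open>(- w2, w1)\<close> and \<open>(- z2, z1)\<close> complete the
    minimising pair to unimodular bases, and \<open>e\<close> is the value of the form on them. The
    two mixed values vanish.\<close>
  define e where "e = - w2 * (p * - z2 + q * z1) + w1 * (r * - z2 + s * z1)"
  have zero: "x1 * (p * - z2 + q * z1) + x2 * (r * - z2 + s * z1) = 0"
    using z by algebra
  have zero': "- w2 * (p * y1 + q * y2) + w1 * (r * y1 + s * y2) = 0"
    using w by algebra
  \<comment> \<open>At the sum of both left basis vectors the form takes all values
    \<open>g * k1 + e * k2\<close>, so minimality forces \<open>g\<close> to divide
    \<open>e\<close>.\<close>
  have "B (x1 - w2) (x2 + w1) (y1 * k1 - z2 * k2) (y2 * k1 + z1 * k2) = g * k1 + e * k2" for k1 k2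
  proof -
    have "B (x1 - w2) (x2 + w1) (y1 * k1 - z2 * k2) (y2 * k1 + z1 * k2) =
      B x1 x2 y1 y2 * k1 + (x1 * (p * - z2 + q * z1) + x2 * (r * - z2 + s * z1)) * k2 +
        (- w2 * (p * y1 + q * y2) + w1 * (r * y1 + s * y2)) * k1 + e * k2"
      by (simp add: B_def e_def algebra_simps)
    then show ?thesis unfolding zero zero' g(2) by simp
  qed
  then have "g dvd g \<and> g dvd e"
    using g(1) min by (intro minimal_combination_dvd[of g g 1 e 0]) (auto, metis)
  then show ?thesis
    using that[of x1 w1 x2 "- w2" y1 z1 "- z2" y2 g e] g one zero zero'
    by (simp add: B_def e_def algebra_simps)
qed

text \<open>After the changes of basis \<open>u\<close> and \<open>v\<close> the map is diagonal, so
  its image is described by divisibility and its kernel by vanishing coordinates. Divisibility by 0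
  means being 0, which covers the degenerate ranks uniformly.\<close>

lemma smith_normal_form:
  fixes p q r s :: int
  obtains u11 u22 u12 u21 v11 v22 v12 v21 :: int and c1 c2 :: nat
  where "u11 * u22 - u12 * u21 = 1" "v11 * v22 - v12 * v21 = 1" "c1 dvd c2"
    "int (c1 * c2) = \<bar>p * s - q * r\<bar>" "int c1 = gcd (gcd p q) (gcd r s)"
    "\<And>i j. (\<exists>x y. p * x + q * y = i \<and> r * x + s * y = j) \<longleftrightarrow>
      int c1 dvd u11 * i + u12 * j \<and> int c2 dvd u21 * i + u22 * j"
    "\<And>x y. p * (v11 * x + v12 * y) + q * (v21 * x + v22 * y) = 0 \<and>
        r * (v11 * x + v12 * y) + s * (v21 * x + v22 * y) = 0 \<longleftrightarrow>
      (c1 = 0 \<or> x = 0) \<and> (c2 = 0 \<or> y = 0)"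
proof -
  obtain u11 u12 u21 u22 v11 v12 v21 v22 c d :: int
    where u: "u11 * u22 - u12 * u21 = 1" and v: "v11 * v22 - v12 * v21 = 1"
      and c: "0 \<le> c" "c dvd d"
      and e: "u11 * (p * v11 + q * v21) + u12 * (r * v11 + s * v21) = c"
      "u11 * (p * v12 + q * v22) + u12 * (r * v12 + s * v22) = 0"
      "u21 * (p * v11 + q * v21) + u22 * (r * v11 + s * v21) = 0"
      "u21 * (p * v12 + q * v22) + u22 * (r * v12 + s * v22) = d"
    by (rule smith_diagonalisation)
  have diag1: "u11 * (p * (v11 * x + v12 * y) + q * (v21 * x + v22 * y)) +
      u12 * (r * (v11 * x + v12 * y) + s * (v21 * x + v22 * y)) = c * x" for x y
  proof -
    have "u11 * (p * (v11 * x + v12 * y) + q * (v21 * x + v22 * y)) +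
        u12 * (r * (v11 * x + v12 * y) + s * (v21 * x + v22 * y)) =
      (u11 * (p * v11 + q * v21) + u12 * (r * v11 + s * v21)) * x +
        (u11 * (p * v12 + q * v22) + u12 * (r * v12 + s * v22)) * y"
      by (simp add: algebra_simps)
    then show ?thesis unfolding e by simp
  qed
  have diag2: "u21 * (p * (v11 * x + v12 * y) + q * (v21 * x + v22 * y)) +
      u22 * (r * (v11 * x + v12 * y) + s * (v21 * x + v22 * y)) = d * y" for x y
  proof -
    have "u21 * (p * (v11 * x + v12 * y) + q * (v21 * x + v22 * y)) +
        u22 * (r * (v11 * x + v12 * y) + s * (v21 * x + v22 * y)) =
      (u21 * (p * v11 + q * v21) + u22 * (r * v11 + s * v21)) * x +
        (u21 * (p * v12 + q * v22) + u22 * (r * v12 + s * v22)) * y"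
      by (simp add: algebra_simps)
    then show ?thesis unfolding e by simp
  qed
  note diag = diag1 diag2
  have inj: "A = i \<and> B = j"
    if "u11 * A + u12 * B = u11 * i + u12 * j" "u21 * A + u22 * B = u21 * i + u22 * j" for A B i j
  proof
    show "A = i" using that u by algebra
    show "B = j" using that u by algebra
  qed
  \<comment> \<open>The vector \<open>(v22 * x - v12 * y, v11 * y - v21 * x)\<close> is the inverse
    of \<open>v\<close> applied to \<open>(x, y)\<close>.\<close>
  have V1: "v11 * (v22 * x - v12 * y) + v12 * (v11 * y - v21 * x) = x" for x y
    using v by algebra
  have V2: "v21 * (v22 * x - v12 * y) + v22 * (v11 * y - v21 * x) = y" for x y
    using v by algebra
  have "c dvd u11 * i + u12 * j \<and> d dvd u21 * i + u22 * j"
    if "p * x + q * y = i" "r * x + s * y = j" for x y i j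
    using diag[of "v22 * x - v12 * y" "v11 * y - v21 * x"] that
    unfolding V1 V2 by (metis dvd_triv_left)
  moreover have "\<exists>x y. p * x + q * y = i \<and> r * x + s * y = j"
    if dvd: "c dvd u11 * i + u12 * j" "d dvd u21 * i + u22 * j" for i j
  proof -
    obtain x y where "u11 * i + u12 * j = c * x" "u21 * i + u22 * j = d * y"
      using dvd by (auto elim!: dvdE)
    then show ?thesis using inj diag by metis
  qed
  ultimately have image: "(\<exists>x y. p * x + q * y = i \<and> r * x + s * y = j) \<longleftrightarrow>
      c dvd u11 * i + u12 * j \<and> d dvd u21 * i + u22 * j" for i j by blast
  have "p * (v11 * x + v12 * y) + q * (v21 * x + v22 * y) = 0 \<and>
        r * (v11 * x + v12 * y) + s * (v21 * x + v22 * y) = 0 \<longleftrightarrow> c * x = 0 \<and> d * y = 0" for x y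
    using diag[of x y] inj[of "p * (v11 * x + v12 * y) + q * (v21 * x + v22 * y)"
        "r * (v11 * x + v12 * y) + s * (v21 * x + v22 * y)" 0 0] by auto
  note kernel = this
  have det: "c * d = p * s - q * r"
  proof -
    have "(u11 * (p * v11 + q * v21) + u12 * (r * v11 + s * v21)) *
        (u21 * (p * v12 + q * v22) + u22 * (r * v12 + s * v22)) -
      (u11 * (p * v12 + q * v22) + u12 * (r * v12 + s * v22)) *
        (u21 * (p * v11 + q * v21) + u22 * (r * v11 + s * v21)) =
      (u11 * u22 - u12 * u21) * (v11 * v22 - v12 * v21) * (p * s - q * r)"
      by (simp add: algebra_simps)
    then show ?thesis unfolding e u v by simp
  qed
  have gcd: "c = gcd (gcd p q) (gcd r s)"
  proof (rule zdvd_antisym_nonneg)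
    have "c dvd i \<and> c dvd j" if "p * x + q * y = i" "r * x + s * y = j" for x y i j
    proof -
      have "c dvd u11 * i + u12 * j" "c dvd u21 * i + u22 * j"
        using image that c(2) dvd_trans by blast+
      moreover have "i = u22 * (u11 * i + u12 * j) - u12 * (u21 * i + u22 * j)"
        using u by algebra
      moreover have "j = u11 * (u21 * i + u22 * j) - u21 * (u11 * i + u12 * j)"
        using u by algebra
      ultimately show ?thesis by (metis dvd_diff dvd_mult)
    qed
    from this[of 1 0] this[of 0 1] show "c dvd gcd (gcd p q) (gcd r s)" by simp
    show "gcd (gcd p q) (gcd r s) dvd c"
      unfolding e(1)[symmetric] by (intro dvd_add dvd_mult dvd_mult2) (auto intro: dvd_trans[OF gcd_dvd1] dvd_trans[OF gcd_dvd2])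
  qed (use c in auto)
  obtain c1 where c1: "c = int c1" using c(1) nonneg_int_cases by blast
  \<comment> \<open>The entry \<open>d\<close> can be negative; divisibility and vanishing depend
    only on its absolute value.\<close>
  have c2: "d dvd i \<longleftrightarrow> int (nat \<bar>d\<bar>) dvd i" "d = 0 \<longleftrightarrow> nat \<bar>d\<bar> = 0" for i
    by auto
  show ?thesis
  proof (rule that[of u11 u22 u12 u21 v11 v22 v12 v21 c1 "nat \<bar>d\<bar>"])
    show "c1 dvd nat \<bar>d\<bar>" using c(2) by (simp add: c1 dvd_nat_abs_iff)
    show "int (c1 * nat \<bar>d\<bar>) = \<bar>p * s - q * r\<bar>"
      unfolding det[symmetric] by (simp add: c1 abs_mult)
    show "int c1 = gcd (gcd p q) (gcd r s)" using gcd by (simp add: c1)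
  qed (use u v image[unfolded c1 c2(1)] kernel[unfolded c1 mult_eq_0_iff c2(2)] in auto)
qed

section \<open>Torus bundle groups\<close>

text \<open>The discrete primitive that vanishes at 0; the negated sum below 0 makes the difference
  equation hold at every integer. It supplies surjectivity in all three exact steps.\<close>

definition antidiff :: "(int \<Rightarrow> int) \<Rightarrow> int \<Rightarrow> int" where
  "antidiff \<psi> k = (if k \<ge> 0 then \<Sum>i\<in>{0..<k}. \<psi> i else - (\<Sum>i\<in>{k..<0}. \<psi> i))"

lemma antidiff_diff: "antidiff \<psi> (1 + k) - antidiff \<psi> k = \<psi> k"
proof (cases "k \<ge> 0")
  case True
  then have "{0..<1 + k} = insert k {0..<k}" by auto
  then show ?thesis using True by (simp add: antidiff_def)
next
  case False
  then have "{k..<0} = insert k {1 + k..<0}" by auto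
  then show ?thesis using False by (auto simp: antidiff_def)
qed

lemma int_shift_invariant:
  assumes "\<And>k::int. \<psi> (1 + k) = \<psi> k"
  shows "\<psi> k = \<psi> 0"
proof (induction k rule: int_induct[of _ 0])
  case (step1 i)
  then show ?case using assms[of i] by (simp add: add.commute)
next
  case (step2 i)
  then show ?case using assms[of "i - 1"] by simp
qed simp

section \<open>The automorphism, its powers and the group law\<close>

locale torus_bundle =
  fixes \<theta> :: "int^2^2" and \<alpha> \<beta> \<gamma> \<delta> :: int
  assumes theta: "\<theta> = vector [vector [\<alpha>, \<gamma>], vector [\<beta>, \<delta>]]"
    and GL2: "invertible \<theta>"
begin

lemma entries: "\<theta>$1$1 = \<alpha>" "\<theta>$1$2 = \<gamma>" "\<theta>$2$1 = \<beta>" "\<theta>$2$2 = \<delta>"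
  by (simp_all add: theta)

lemma det_theta: "det \<theta> = \<alpha> * \<delta> - \<beta> * \<gamma>"
  by (simp add: det_2 entries)

lemma det_cases: "det \<theta> = 1 \<or> det \<theta> = -1"
proof -
  obtain B where "\<theta> ** B = mat 1" using GL2 by (auto simp: invertible_def)
  then have "det \<theta> * det B = 1" by (metis det_mul det_I)
  then show ?thesis by (auto simp: zmult_eq_1_iff)
qed

abbreviation "Aut \<equiv> AutoGroup (integer_group \<times>\<times> integer_group)"

definition pw :: "int \<Rightarrow> int \<times> int \<Rightarrow> int \<times> int" where
  "pw k = lattice_aut \<theta> [^]\<^bsub>Aut\<^esub> k"

lemma group_Aut: "group Aut"
  by (intro group.AutoGroup DirProd_group) simp_all

lemma carrier_Aut: "carrier Aut = {f. bij f \<and> (\<forall>v w. f (v + w) = f v + f w)}"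
  by (auto simp: AutoGroup_def auto_def Bij_def hom_def mult_DirProd' plus_prod_def)

lemma mult_Aut: "f \<in> carrier Aut \<Longrightarrow> g \<in> carrier Aut \<Longrightarrow> f \<otimes>\<^bsub>Aut\<^esub> g = f \<circ> g"
  by (auto simp: AutoGroup_def BijGroup_def auto_def compose_def fun_eq_iff)

lemma one_Aut: "\<one>\<^bsub>Aut\<^esub> = id"
  by (auto simp: AutoGroup_def BijGroup_def fun_eq_iff)

lemma lattice_aut_pair: "lattice_aut \<theta> (m, n) = (\<alpha> * m + \<gamma> * n, \<beta> * m + \<delta> * n)"
  by (simp add: lattice_aut_def entries)

lemma lattice_aut_in_Aut: "lattice_aut \<theta> \<in> carrier Aut"
proof -
  define d where "d = det \<theta>"
  have d: "d * (\<alpha> * \<delta> - \<beta> * \<gamma>) = 1"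
    using det_cases by (auto simp: d_def det_theta)
  \<comment> \<open>The inverse matrix is the adjugate divided by the determinant; as the
    determinant is 1 or -1, dividing by it is multiplying by it.\<close>
  define g where "g = (\<lambda>(m, n). (d * (\<delta> * m - \<gamma> * n), d * (\<alpha> * n - \<beta> * m)))"
  have "\<delta> * (\<alpha> * m + \<gamma> * n) - \<gamma> * (\<beta> * m + \<delta> * n) = (\<alpha> * \<delta> - \<beta> * \<gamma>) * m"
    "\<alpha> * (\<beta> * m + \<delta> * n) - \<beta> * (\<alpha> * m + \<gamma> * n) = (\<alpha> * \<delta> - \<beta> * \<gamma>) * n"
    "\<alpha> * (d * (\<delta> * m - \<gamma> * n)) + \<gamma> * (d * (\<alpha> * n - \<beta> * m)) = d * (\<alpha> * \<delta> - \<beta> * \<gamma>) * m"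
    "\<beta> * (d * (\<delta> * m - \<gamma> * n)) + \<delta> * (d * (\<alpha> * n - \<beta> * m)) = d * (\<alpha> * \<delta> - \<beta> * \<gamma>) * n"
    for m n by (simp_all add: algebra_simps)
  then have "g \<circ> lattice_aut \<theta> = id" "lattice_aut \<theta> \<circ> g = id"
    using d by (auto simp: fun_eq_iff g_def lattice_aut_pair simp flip: mult.assoc)
  then have "bij (lattice_aut \<theta>)" by (rule o_bij)
  then show ?thesis
    by (auto simp: carrier_Aut lattice_aut_pair algebra_simps)
qed

lemma pw_in_Aut: "pw k \<in> carrier Aut"
  unfolding pw_def by (rule group.int_pow_closed[OF group_Aut lattice_aut_in_Aut])

lemma pw_add: "pw k (v + w) = pw k v + pw k w"
  using pw_in_Aut[of k] unfolding carrier_Aut by blast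

lemma pw_0 [simp]: "pw 0 v = v"
  unfolding pw_def by (simp add: one_Aut)

lemma pw_plus: "pw (k + l) v = pw k (pw l v)"
proof -
  have "pw (k + l) = pw k \<otimes>\<^bsub>Aut\<^esub> pw l"
    unfolding pw_def by (rule group.int_pow_mult[OF group_Aut lattice_aut_in_Aut])
  then show ?thesis by (simp add: mult_Aut pw_in_Aut)
qed

lemma pw_1: "pw 1 (m, n) = (\<alpha> * m + \<gamma> * n, \<beta> * m + \<delta> * n)"
proof -
  have "pw 1 = lattice_aut \<theta>"
    unfolding pw_def
    by (rule group.int_pow_1[OF group_Aut lattice_aut_in_Aut])
  then show ?thesis by (simp add: lattice_aut_pair)
qed

lemma zero_pair_add [simp]: "(0, 0) + v = v" "v + (0, 0) = v" for v :: "int \<times> int"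
  by (cases v; simp)+

lemma pw_zero [simp]: "pw k (0, 0) = (0, 0)"
  using pw_add[of k "(0, 0)" "(0, 0)"] by (cases "pw k (0, 0)") simp

abbreviation "G \<equiv> torus_bundle_group \<theta>"

lemma carrier_G: "carrier G = UNIV"
  by (simp add: torus_bundle_group_def semidirect_product_def)

lemma mult_G [simp]: "(v, k) \<otimes>\<^bsub>G\<^esub> (w, l) = (v + pw k w, k + l)"
  by (simp add: torus_bundle_group_def semidirect_product_def pw_def mult_DirProd' plus_prod_def)

lemma one_G: "\<one>\<^bsub>G\<^esub> = ((0, 0), 0)"
  by (simp add: torus_bundle_group_def semidirect_product_def)

end

sublocale torus_bundle \<subseteq> full_monoid "torus_bundle_group \<theta>"
proof unfold_locales
  fix x y z
  show "x \<otimes>\<^bsub>G\<^esub> y \<otimes>\<^bsub>G\<^esub> z = x \<otimes>\<^bsub>G\<^esub> (y \<otimes>\<^bsub>G\<^esub> z)"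
    by (cases x; cases y; cases z) (simp add: pw_add pw_plus add.assoc)
  show "\<one>\<^bsub>G\<^esub> \<otimes>\<^bsub>G\<^esub> x = x" "x \<otimes>\<^bsub>G\<^esub> \<one>\<^bsub>G\<^esub> = x"
    by (cases x; simp add: one_G)+
qed (auto simp: carrier_G)

section \<open>The three generators, the functions they leave invariant, and the exact steps\<close>

context torus_bundle
begin

definition a :: "(int \<times> int) \<times> int" where "a = ((1, 0), 0)"
definition b :: "(int \<times> int) \<times> int" where "b = ((0, 1), 0)"
definition t :: "(int \<times> int) \<times> int" where "t = ((0, 0), 1)"

lemma a_mult: "a \<otimes>\<^bsub>G\<^esub> ((m, n), k) = ((1 + m, n), k)"
  and b_mult: "b \<otimes>\<^bsub>G\<^esub> ((m, n), k) = ((m, 1 + n), k)"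
  and t_mult: "t \<otimes>\<^bsub>G\<^esub> (v, k) = (pw 1 v, 1 + k)"
  by (simp_all add: a_def b_def t_def)

lemma Inv_a_iff: "\<phi> \<in> Inv {a} \<longleftrightarrow> (\<forall>m n k. \<phi> ((m, n), k) = \<phi> ((0, n), k))"
proof
  assume *: "\<phi> \<in> Inv {a}"
  show "\<forall>m n k. \<phi> ((m, n), k) = \<phi> ((0, n), k)"
  proof (intro allI)
    fix m n k :: int
    have "\<phi> ((1 + m, n), k) = \<phi> ((m, n), k)" for m
      using * by (simp add: Inv_def flip: a_mult)
    then show "\<phi> ((m, n), k) = \<phi> ((0, n), k)" by (rule int_shift_invariant)
  qed
next
  assume *: "\<forall>m n k. \<phi> ((m, n), k) = \<phi> ((0, n), k)"
  have "\<phi> ((1 + m, n), k) = \<phi> ((m, n), k)" for m n k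
    using *[rule_format, of "1 + m" n k] *[rule_format, of m n k] by (rule trans[OF _ sym])
  then show "\<phi> \<in> Inv {a}" by (auto simp: Inv_def a_mult)
qed

lemma Inv_ba_iff: "\<phi> \<in> Inv {b, a} \<longleftrightarrow> (\<forall>v k. \<phi> (v, k) = \<phi> ((0, 0), k))"
proof
  assume *: "\<phi> \<in> Inv {b, a}"
  show "\<forall>v k. \<phi> (v, k) = \<phi> ((0, 0), k)"
  proof (intro allI)
    fix v :: "int \<times> int" and k :: int
    obtain m n where v: "v = (m, n)" by (cases v)
    have "\<phi> ((0, 1 + n), k) = \<phi> ((0, n), k)" for n
      using * by (simp add: Inv_def flip: b_mult)
    then have "\<phi> ((0, n), k) = \<phi> ((0, 0), k)" by (rule int_shift_invariant)
    moreover have "\<phi> \<in> Inv {a}" using * Inv_mono[of "{a}" "{b, a}"] by blast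
    then have "\<phi> (v, k) = \<phi> ((0, n), k)" unfolding Inv_a_iff v by blast
    ultimately show "\<phi> (v, k) = \<phi> ((0, 0), k)" by simp
  qed
next
  assume *: "\<forall>v k. \<phi> (v, k) = \<phi> ((0, 0), k)"
  have eq: "\<phi> (v, k) = \<phi> (w, k)" for v w k
    using *[rule_format, of v k] *[rule_format, of w k] by (rule trans[OF _ sym])
  show "\<phi> \<in> Inv {b, a}" by (auto simp: Inv_def a_mult b_mult intro: eq)
qed

lemma Inv_tba_iff: "\<phi> \<in> Inv {t, b, a} \<longleftrightarrow> (\<forall>x. \<phi> x = \<phi> \<one>\<^bsub>G\<^esub>)"
proof
  assume *: "\<phi> \<in> Inv {t, b, a}"
  show "\<forall>x. \<phi> x = \<phi> \<one>\<^bsub>G\<^esub>"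
  proof
    fix x :: "(int \<times> int) \<times> int"
    obtain v k where x: "x = (v, k)" by (cases x)
    have "\<phi> (t \<otimes>\<^bsub>G\<^esub> ((0, 0), k)) = \<phi> ((0, 0), k)" for k
      using * by (simp add: Inv_def)
    then have "\<phi> ((0, 0), 1 + k) = \<phi> ((0, 0), k)" for k
      by (simp add: t_mult)
    then have "\<phi> ((0, 0), k) = \<phi> ((0, 0), 0)" by (rule int_shift_invariant)
    moreover have "\<phi> \<in> Inv {b, a}" using * Inv_mono[of "{b, a}" "{t, b, a}"] by blast
    then have "\<phi> x = \<phi> ((0, 0), k)" unfolding Inv_ba_iff x by blast
    ultimately show "\<phi> x = \<phi> \<one>\<^bsub>G\<^esub>" by (simp add: one_G)
  qed
next
  assume *: "\<forall>x. \<phi> x = \<phi> \<one>\<^bsub>G\<^esub>"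
  have eq: "\<phi> x = \<phi> y" for x y
    using *[rule_format, of x] *[rule_format, of y] by (rule trans[OF _ sym])
  show "\<phi> \<in> Inv {t, b, a}" unfolding Inv_def by (blast intro: eq)
qed

end

sublocale torus_bundle \<subseteq> A: exact_step "torus_bundle_group \<theta>" "{}" a
proof unfold_locales
  fix \<phi> :: "(int \<times> int) \<times> int \<Rightarrow> int"
  show "(\<lambda>x. \<phi> (a \<otimes>\<^bsub>G\<^esub> x)) \<in> Inv {}" by (rule Inv_empty)
  show "\<exists>\<psi>\<in>Inv {}. \<forall>x. \<psi> (a \<otimes>\<^bsub>G\<^esub> x) - \<psi> x = \<phi> x"
    by (rule bexI[of _ "\<lambda>((m, n), k). antidiff (\<lambda>i. \<phi> ((i, n), k)) m"])
      (auto simp: a_mult antidiff_diff Inv_empty)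
qed

sublocale torus_bundle \<subseteq> B: exact_step "torus_bundle_group \<theta>" "{a}" b
proof unfold_locales
  fix \<phi> :: "(int \<times> int) \<times> int \<Rightarrow> int" assume \<phi>: "\<phi> \<in> Inv {a}"
  show "(\<lambda>x. \<phi> (b \<otimes>\<^bsub>G\<^esub> x)) \<in> Inv {a}"
    using \<phi> by (simp add: Inv_a_iff b_mult)
  have "\<phi> ((0, n), k) = \<phi> ((m, n), k)" for m n k
    using \<phi> unfolding Inv_a_iff by (blast intro: sym)
  then show "\<exists>\<psi>\<in>Inv {a}. \<forall>x. \<psi> (b \<otimes>\<^bsub>G\<^esub> x) - \<psi> x = \<phi> x"
    by (intro bexI[of _ "\<lambda>((m, n), k). antidiff (\<lambda>i. \<phi> ((0, i), k)) n"])
      (auto simp: b_mult antidiff_diff Inv_a_iff)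
qed

text \<open>Left translation by \<open>t\<close> also moves the lattice part by
  \<open>\<theta>\<close>, but functions in \<open>Inv {b, a}\<close> depend on the last coordinate
  alone. There \<open>t\<close> is a plain shift, so summation along that coordinate inverts
  \<open>\<Delta> t\<close>.\<close>

sublocale torus_bundle \<subseteq> T: exact_step "torus_bundle_group \<theta>" "{b, a}" t
proof unfold_locales
  fix \<phi> :: "(int \<times> int) \<times> int \<Rightarrow> int" assume \<phi>: "\<phi> \<in> Inv {b, a}"
  then have \<phi>': "\<phi> (v, k) = \<phi> ((0, 0), k)" for v k
    unfolding Inv_ba_iff by blast
  show "(\<lambda>x. \<phi> (t \<otimes>\<^bsub>G\<^esub> x)) \<in> Inv {b, a}"
    unfolding Inv_ba_iff t_mult pw_zero using \<phi>' by blast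
  show "\<exists>\<psi>\<in>Inv {b, a}. \<forall>x. \<psi> (t \<otimes>\<^bsub>G\<^esub> x) - \<psi> x = \<phi> x"
  proof (intro bexI allI)
    fix x :: "(int \<times> int) \<times> int"
    show "(\<lambda>(v, k). antidiff (\<lambda>i. \<phi> ((0, 0), i)) k) (t \<otimes>\<^bsub>G\<^esub> x) -
        (\<lambda>(v, k). antidiff (\<lambda>i. \<phi> ((0, 0), i)) k) x = \<phi> x"
      using \<phi>'[of "fst x" "snd x"] by (cases x) (simp add: t_mult antidiff_diff)
  qed (simp add: Inv_ba_iff)
qed

section \<open>Cohomology with coefficients coinduced from the fibre group\<close>

context torus_bundle
begin

text \<open>Each step raises the degree from which cohomology vanishes by one: 1 for all functions,
  then 2, 3 and 4.\<close>

lemma H_a_trivial: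
  assumes "cocycle {a} (Suc (Suc m)) F"
  shows "is_coboundary {a} (Suc (Suc m)) F"
  by (rule A.coboundary_of_vanishing[OF _ _ assms]) (erule coboundary_of_free)+

lemma H_ba_trivial:
  assumes "cocycle {b, a} (Suc (Suc (Suc m))) F"
  shows "is_coboundary {b, a} (Suc (Suc (Suc m))) F"
  by (rule B.coboundary_of_vanishing[OF _ _ assms]) (erule H_a_trivial)+

lemma H_tba_trivial:
  assumes "cocycle {t, b, a} (Suc (Suc (Suc (Suc m)))) F"
  shows "is_coboundary {t, b, a} (Suc (Suc (Suc (Suc m)))) F"
  by (rule T.coboundary_of_vanishing[OF _ _ assms]) (erule H_ba_trivial)+

definition ev1 :: "(((int \<times> int) \<times> int) list \<Rightarrow> (int \<times> int) \<times> int \<Rightarrow> int) \<Rightarrow> int \<times> int" where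
  "ev1 F = (F [a] \<one>\<^bsub>G\<^esub>, F [b] \<one>\<^bsub>G\<^esub>)"

text \<open>The pairing with the fundamental class \<open>[a|b] - [b|a]\<close> of the
  torus.\<close>

definition ev2 :: "(((int \<times> int) \<times> int) list \<Rightarrow> (int \<times> int) \<times> int \<Rightarrow> int) \<Rightarrow> int" where
  "ev2 F = F [a, b] \<one>\<^bsub>G\<^esub> - F [b, a] \<one>\<^bsub>G\<^esub>"

lemma H1_a:
  assumes "cocycle {a} (Suc 0) F" and "F [a] \<one>\<^bsub>G\<^esub> = 0"
  shows "is_coboundary {a} (Suc 0) F"
  using assms by (intro A.coboundary_1_step coboundary_of_free) (auto intro: cocycle_mono)

lemma H1_ba:
  assumes F: "cocycle {b, a} (Suc 0) F"
  shows "is_coboundary {b, a} (Suc 0) F \<longleftrightarrow> ev1 F = 0"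
proof
  assume "is_coboundary {b, a} (Suc 0) F"
  then show "ev1 F = 0"
    by (simp add: ev1_def zero_prod_def coboundary_1_eval)
next
  assume "ev1 F = 0"
  then show "is_coboundary {b, a} (Suc 0) F"
    using F cocycle_mono[of "{a}" "{b, a}"]
    by (intro B.coboundary_1_step H1_a) (auto simp: ev1_def zero_prod_def)
qed

text \<open>The terms at \<open>a b = b a\<close> cancel and \<open>h [b]\<close> is invariant under
  \<open>a\<close>; only the change of \<open>h [a]\<close> under \<open>b\<close> survives. This
  reduces degree 2 over \<open>Inv {b, a}\<close> to the obstruction of \<open>H1_a\<close>.\<close>

lemma ev2_primitive:
  assumes "cobounds {a} (Suc 0) h F"
  shows "ev2 F = - \<Delta> b h [a] \<one>\<^bsub>G\<^esub>"
proof -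
  have "h [b] \<in> Inv {a}"
    using assms by (simp add: cobounds_def cochain_def)
  then have "h [b] (a \<otimes>\<^bsub>G\<^esub> \<one>\<^bsub>G\<^esub>) = h [b] \<one>\<^bsub>G\<^esub>"
    unfolding Inv_def by blast
  moreover have "a \<otimes>\<^bsub>G\<^esub> b = b \<otimes>\<^bsub>G\<^esub> a"
    by (simp add: a_def b_def)
  ultimately show ?thesis
    using assms by (simp add: ev2_def cobounds_def cobd_def \<Delta>_def)
qed

lemma H2_ba:
  assumes F: "cocycle {b, a} (Suc (Suc 0)) F"
  shows "is_coboundary {b, a} (Suc (Suc 0)) F \<longleftrightarrow> ev2 F = 0"
proof
  assume "is_coboundary {b, a} (Suc (Suc 0)) F"
  then obtain h where h: "cobounds {b, a} (Suc 0) h F"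
    by (auto simp: is_coboundary_Suc)
  then have "\<Delta> b h [a] \<one>\<^bsub>G\<^esub> = 0"
    by (simp add: cobounds_def cochain_insert_iff del: split_paired_All)
  then show "ev2 F = 0"
    using ev2_primitive[OF cobounds_mono[OF _ h]] by auto
next
  assume *: "ev2 F = 0"
  have "cocycle {a} (Suc (Suc 0)) F" by (rule cocycle_mono[OF _ F]) auto
  then obtain h where h: "cobounds {a} (Suc 0) h F"
    using H_a_trivial[of 0 F] by (auto simp: is_coboundary_Suc)
  have "is_coboundary {a} (Suc 0) (\<Delta> b h)"
    using B.\<Delta>_primitive_cocycle[OF F h] ev2_primitive[OF h] * by (intro H1_a) auto
  with h show "is_coboundary {b, a} (Suc (Suc 0)) F"
    by (rule B.coboundary_if_primitive_coboundary)
qed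

section \<open>Explicit cocycles on the fibre and the action of \<open>t\<close> on their
  classes\<close>

lemma ev1_diff: "ev1 (\<lambda>gs x. F gs x - F' gs x) = ev1 F - ev1 F'"
  by (simp add: ev1_def)

lemma ev2_diff: "ev2 (\<lambda>gs x. F gs x - F' gs x) = ev2 F - ev2 F'"
  by (simp add: ev2_def)

text \<open>The coboundary of a linear function of the lattice coordinates. The function need not
  lie in \<open>Inv {b, a}\<close>, but its coboundary does, which makes it a representative of the
  class with \<open>ev1\<close> equal to \<open>u\<close>.\<close>

definition lin_cocycle :: "int \<times> int \<Rightarrow> ((int \<times> int) \<times> int) list \<Rightarrow> (int \<times> int) \<times> int \<Rightarrow> int" where
  "lin_cocycle u = cobd (\<lambda>_ x. fst u * fst (fst x) + snd u * snd (fst x))"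

lemma lin_cocycle_eval: "lin_cocycle u [(w, l)] (v, k) = fst u * fst (pw k w) + snd u * snd (pw k w)"
  by (simp add: lin_cocycle_def cobd_def algebra_simps)

lemma cocycle_lin_cocycle: "cocycle {b, a} (Suc 0) (lin_cocycle u)"
  unfolding cocycle_def cochain_def
proof (intro conjI allI impI)
  fix gs :: "((int \<times> int) \<times> int) list" assume "length gs = Suc 0"
  then obtain w l where "gs = [(w, l)]"
    by (cases gs) auto
  then show "lin_cocycle u gs \<in> Inv {b, a}"
    by (simp add: Inv_ba_iff lin_cocycle_eval)
qed (simp add: lin_cocycle_def cobd_cobd)

lemma ev1_lin_cocycle: "ev1 (lin_cocycle u) = u"
  by (cases u) (simp add: ev1_def a_def b_def one_G lin_cocycle_eval)

text \<open>Subtracting the linear cocycle with the same \<open>ev1\<close> leaves a coboundary, and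
  \<open>\<Delta> t\<close> preserves coboundaries. On the linear cocycle, translation by
  \<open>t\<close> precomposes with \<open>\<theta>\<close>, so the matrix is the transpose of
  \<open>\<theta>\<close> minus the identity.\<close>

lemma ev1_\<Delta>:
  assumes F: "cocycle {b, a} (Suc 0) F" and "ev1 F = (p, q)"
  shows "ev1 (\<Delta> t F) = ((\<alpha> - 1) * p + \<beta> * q, \<gamma> * p + (\<delta> - 1) * q)"
proof -
  let ?L = "lin_cocycle (p, q)"
  have "cocycle {b, a} (Suc 0) (\<lambda>gs x. F gs x - ?L gs x)"
    by (intro cocycle_diff F cocycle_lin_cocycle)
  moreover have "ev1 (\<lambda>gs x. F gs x - ?L gs x) = 0"
    using assms(2) by (simp add: ev1_diff ev1_lin_cocycle)
  ultimately have "is_coboundary {b, a} (Suc 0) (\<Delta> t (\<lambda>gs x. F gs x - ?L gs x))"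
    by (intro T.is_coboundary_\<Delta>) (simp add: H1_ba)
  then have "ev1 (\<Delta> t (\<lambda>gs x. F gs x - ?L gs x)) = 0"
    by (subst (asm) H1_ba) (intro T.cocycle_\<Delta> cocycle_diff F cocycle_lin_cocycle)
  then have "ev1 (\<Delta> t F) = ev1 (\<Delta> t ?L)"
    by (simp add: ev1_def \<Delta>_def zero_prod_def)
  also have "\<dots> = ((\<alpha> - 1) * p + \<beta> * q, \<gamma> * p + (\<delta> - 1) * q)"
    by (simp add: ev1_def \<Delta>_def a_def b_def t_def one_G lin_cocycle_eval pw_1 algebra_simps)
  finally show ?thesis .
qed

text \<open>Up to sign, the cup product of the two coordinate classes.\<close>

definition area_cocycle :: "((int \<times> int) \<times> int) list \<Rightarrow> (int \<times> int) \<times> int \<Rightarrow> int" where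
  "area_cocycle = cobd (\<lambda>gs x. - (snd (fst x) * lin_cocycle (1, 0) gs x))"

lemma area_cocycle_eval:
  "area_cocycle [(w, l), (w', l')] (v, k) = - (snd (pw k w) * fst (pw (k + l) w'))"
  by (simp add: area_cocycle_def cobd_def lin_cocycle_eval pw_add pw_plus algebra_simps)

lemma cocycle_area_cocycle: "cocycle {b, a} (Suc (Suc 0)) area_cocycle"
  unfolding cocycle_def cochain_def
proof (intro conjI allI impI)
  fix gs :: "((int \<times> int) \<times> int) list" assume "length gs = Suc (Suc 0)"
  then obtain w l w' l' where "gs = [(w, l), (w', l')]"
    by (auto simp: length_Suc_conv)
  then show "area_cocycle gs \<in> Inv {b, a}"
    by (simp add: Inv_ba_iff area_cocycle_eval)
qed (simp add: area_cocycle_def cobd_cobd)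

lemma ev2_area_cocycle: "ev2 area_cocycle = 1"
  by (simp add: ev2_def a_def b_def one_G area_cocycle_eval)

text \<open>As in \<open>ev1_\<Delta>\<close>, it suffices to treat a multiple of
  \<open>area_cocycle\<close>; its antisymmetrisation is an area form on the lattice, which
  \<open>\<theta>\<close> multiplies by its determinant.\<close>

lemma ev2_\<Delta>:
  assumes F: "cocycle {b, a} (Suc (Suc 0)) F"
  shows "ev2 (\<Delta> t F) = (det \<theta> - 1) * ev2 F"
proof -
  let ?L = "\<lambda>gs x. ev2 F * area_cocycle gs x"
  have "cocycle {b, a} (Suc (Suc 0)) (\<lambda>gs x. F gs x - ?L gs x)"
    by (intro cocycle_diff cocycle_scale F cocycle_area_cocycle)
  moreover have "ev2 ?L = ev2 F * ev2 area_cocycle"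
    by (simp add: ev2_def algebra_simps)
  then have "ev2 (\<lambda>gs x. F gs x - ?L gs x) = 0"
    by (simp add: ev2_diff ev2_area_cocycle)
  ultimately have "is_coboundary {b, a} (Suc (Suc 0)) (\<Delta> t (\<lambda>gs x. F gs x - ?L gs x))"
    by (intro T.is_coboundary_\<Delta>) (simp add: H2_ba)
  then have "ev2 (\<Delta> t (\<lambda>gs x. F gs x - ?L gs x)) = 0"
    by (subst (asm) H2_ba) (intro T.cocycle_\<Delta> cocycle_diff cocycle_scale F cocycle_area_cocycle)
  then have "ev2 (\<Delta> t F) = ev2 F * ev2 (\<Delta> t area_cocycle)"
    by (simp add: ev2_def \<Delta>_def algebra_simps)
  also have "ev2 (\<Delta> t area_cocycle) = det \<theta> - 1"
    by (simp add: ev2_def \<Delta>_def a_def b_def t_def one_G area_cocycle_eval pw_1 det_theta)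
  finally show ?thesis by simp
qed

end

section \<open>Integral cohomology of torus bundle groups\<close>

lemma integer_mod_group_zero: "integer_mod_group 0 = integer_group"
  by (simp add: integer_mod_group_def)

lemma range_mod: "range (\<lambda>x. x mod int n) = carrier (integer_mod_group n)"
proof
  show "carrier (integer_mod_group n) \<subseteq> range (\<lambda>x. x mod int n)"
  proof
    fix x assume "x \<in> carrier (integer_mod_group n)"
    then have "x = x mod int n" by (auto simp: carrier_integer_mod_group split: if_splits)
    then show "x \<in> range (\<lambda>x. x mod int n)" by (rule image_eqI) simp
  qed
qed (auto simp: carrier_integer_mod_group)

text \<open>Reduction in the coordinates given by \<open>u\<close>. With the data of
  \<open>smith_normal_form\<close> its kernel is the image of the matrix, so it realises the
  cokernel.\<close>

definition residues2 :: "int \<Rightarrow> int \<Rightarrow> int \<Rightarrow> int \<Rightarrow> nat \<Rightarrow> nat \<Rightarrow> int \<times> int \<Rightarrow> int \<times> int" where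
  "residues2 u11 u12 u21 u22 c1 c2 =
    (\<lambda>(p, q). ((u11 * p + u12 * q) mod int c1, (u21 * p + u22 * q) mod int c2))"

lemma residues2_add:
  "residues2 u11 u12 u21 u22 c1 c2 (v + w) =
    residues2 u11 u12 u21 u22 c1 c2 v \<otimes>\<^bsub>integer_mod_group c1 \<times>\<times> integer_mod_group c2\<^esub>
    residues2 u11 u12 u21 u22 c1 c2 w"
  by (cases v; cases w) (simp add: residues2_def mod_add_eq algebra_simps)

lemma range_residues2:
  assumes "u11 * u22 - u12 * u21 = 1"
  shows "range (residues2 u11 u12 u21 u22 c1 c2) =
    carrier (integer_mod_group c1 \<times>\<times> integer_mod_group c2)"
proof
  show "carrier (integer_mod_group c1 \<times>\<times> integer_mod_group c2) \<subseteq> range (residues2 u11 u12 u21 u22 c1 c2)"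
  proof
    fix y assume "y \<in> carrier (integer_mod_group c1 \<times>\<times> integer_mod_group c2)"
    then obtain i j where y: "y = (i mod int c1, j mod int c2)"
      by (auto simp flip: range_mod)
    have "u11 * (u22 * i - u12 * j) + u12 * (u11 * j - u21 * i) = i"
      using assms by algebra
    moreover have "u21 * (u22 * i - u12 * j) + u22 * (u11 * j - u21 * i) = j"
      using assms by algebra
    ultimately have "y = residues2 u11 u12 u21 u22 c1 c2 (u22 * i - u12 * j, u11 * j - u21 * i)"
      using y by (simp add: residues2_def)
    then show "y \<in> range (residues2 u11 u12 u21 u22 c1 c2)" by (rule image_eqI) simp
  qed
qed (auto simp: residues2_def simp flip: range_mod)

section \<open>Integral cocycles inside the functions invariant under the generators\<close>

context torus_bundle
begin

lemma Inv_tba: "Inv {t, b, a} = Inv UNIV"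
  using Inv_tba_iff Inv_UNIV_iff by blast

lemma cocycle_UNIV: "cocycle UNIV n F \<longleftrightarrow> cocycle {t, b, a} n F"
  and is_coboundary_UNIV: "is_coboundary UNIV n F \<longleftrightarrow> is_coboundary {t, b, a} n F"
  by (cases n; simp add: cocycle_def is_coboundary_def cobounds_def cochain_def Inv_tba)+

lemma cocycle_ba: "cocycle UNIV n F \<Longrightarrow> cocycle {b, a} n F"
  and is_coboundary_ba: "is_coboundary UNIV n F \<Longrightarrow> is_coboundary {b, a} n F"
  by (auto intro: cocycle_mono is_coboundary_mono)

lemma \<Delta>_const: "\<Delta> s (const F) = (\<lambda>_ _. 0)"
  by (simp add: \<Delta>_def fun_eq_iff)

lemma const_representative:
  assumes "cocycle UNIV n F"
  obtains F' where "cocycle UNIV n (const F')" "\<And>gs. length gs = n \<Longrightarrow> const F' gs = F gs"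
proof -
  have *: "const (\<lambda>gs. F gs \<one>\<^bsub>G\<^esub>) gs = F gs" if "length gs = n" for gs
  proof -
    have "F gs \<in> Inv UNIV" using assms that by (simp add: cocycle_def cochain_def)
    then show ?thesis unfolding Inv_UNIV_iff fun_eq_iff by (blast intro: sym)
  qed
  show ?thesis
    by (rule that[OF cocycle_cong[OF assms *] *])
qed

end

text \<open>
  \<open>ev\<close> identifies \<open>H\<^sup>m(G, Inv {b, a})\<close>, that is \<open>H\<^sup>m(\<int>\<^sup>2, \<int>)\<close>, with a group on which \<open>t - 1\<close> acts as \<open>M\<close>.
  The cokernel of \<open>M\<close> then describes the classes in \<open>H\<^sup>m\<^sup>+\<^sup>1(G, \<int>)\<close> that become trivial over \<open>Inv {b, a}\<close>.
\<close>

locale fibre_class = torus_bundle +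
  fixes m :: nat
    and ev :: "(((int \<times> int) \<times> int) list \<Rightarrow> (int \<times> int) \<times> int \<Rightarrow> int) \<Rightarrow> 'v :: ab_group_add"
    and M :: "'v \<Rightarrow> 'v"
  assumes ev_diff: "ev (\<lambda>gs x. F gs x - F' gs x) = ev F - ev F'"
    and ev_eq_0_iff: "cocycle {b, a} m F \<Longrightarrow> is_coboundary {b, a} m F \<longleftrightarrow> ev F = 0"
    and ev_onto: "\<exists>F. cocycle {b, a} m F \<and> ev F = v"
    and ev_\<Delta>: "cocycle {b, a} m F \<Longrightarrow> ev (\<Delta> t F) = M (ev F)"
begin

text \<open>A relation, because changing the primitive \<open>h\<close> by a cocycle
  \<open>z\<close> changes the value by \<open>M (ev z)\<close>: only the class modulo the range of
  \<open>M\<close> is determined by \<open>F\<close>.\<close>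

definition primitive_class :: "(((int \<times> int) \<times> int) list \<Rightarrow> int) \<Rightarrow> 'v \<Rightarrow> bool" where
  "primitive_class F v \<longleftrightarrow> (\<exists>h. cobounds {b, a} m h (const F) \<and> ev (\<Delta> t h) = v)"

lemma ev_cong:
  assumes "cocycle {b, a} m F" "\<And>gs. length gs = m \<Longrightarrow> F' gs = F gs"
  shows "ev F' = ev F"
proof -
  have "cocycle {b, a} m F'" by (rule cocycle_cong[OF assms])
  then have "cocycle {b, a} m (\<lambda>gs x. F' gs x - F gs x)" using assms(1) by (intro cocycle_diff)
  moreover have "is_coboundary {b, a} m (\<lambda>gs x. F' gs x - F gs x)"
    using assms(2) by (intro is_coboundary_of_zero) simp
  ultimately show ?thesis using ev_eq_0_iff ev_diff by simp
qed

lemma primitive_class_total: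
  "is_coboundary {b, a} (Suc m) (const F) \<Longrightarrow> \<exists>v. primitive_class F v"
  by (auto simp: primitive_class_def is_coboundary_Suc)

lemma primitive_class_diff:
  assumes "primitive_class F v" "primitive_class F' v'"
  shows "primitive_class (\<lambda>gs. F gs - F' gs) (v - v')"
proof -
  obtain h h' where h: "cobounds {b, a} m h (const F)" "ev (\<Delta> t h) = v"
    and h': "cobounds {b, a} m h' (const F')" "ev (\<Delta> t h') = v'"
    using assms by (auto simp: primitive_class_def)
  have "\<Delta> t (\<lambda>gs x. h gs x - h' gs x) = (\<lambda>gs x. \<Delta> t h gs x - \<Delta> t h' gs x)"
    by (intro ext) (simp add: \<Delta>_def)
  then have "ev (\<Delta> t (\<lambda>gs x. h gs x - h' gs x)) = v - v'"
    using h(2) h'(2) by (simp add: ev_diff)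
  then show ?thesis
    using cobounds_diff[OF h(1) h'(1)] by (auto simp: primitive_class_def)
qed

lemma primitive_class_onto: "\<exists>F. cocycle UNIV (Suc m) (const F) \<and> primitive_class F v"
proof -
  obtain z where z: "cocycle {b, a} m z" "ev z = v" using ev_onto by blast
  obtain h where h: "cochain {b, a} m h" "\<And>gs. length gs = m \<Longrightarrow> \<Delta> t h gs = z gs"
    and "cocycle {t, b, a} (Suc m) (cobd h)"
    using T.connecting[OF z(1)] by blast
  then obtain F where F: "cocycle UNIV (Suc m) (const F)"
    "\<And>gs. length gs = Suc m \<Longrightarrow> const F gs = cobd h gs"
    using const_representative cocycle_UNIV by metis
  have "ev (\<Delta> t h) = v"
    using ev_cong[OF z(1), of "\<Delta> t h"] h(2) z(2) by simp
  then have "primitive_class F v"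
    using h(1) F(2) by (auto simp: primitive_class_def cobounds_def)
  then show ?thesis using F(1) by blast
qed

text \<open>By exactness \<open>F\<close> is a coboundary if and only if \<open>\<Delta> t h\<close>
  is cohomologous to \<open>\<Delta> t z\<close> for some cocycle \<open>z\<close>; under
  \<open>ev\<close> these classes are the values of \<open>M\<close>.\<close>

lemma primitive_class_kernel:
  assumes F: "cocycle UNIV (Suc m) (const F)" and v: "primitive_class F v"
  shows "is_coboundary UNIV (Suc m) (const F) \<longleftrightarrow> v \<in> range M"
proof -
  obtain h where h: "cobounds {b, a} m h (const F)" "ev (\<Delta> t h) = v"
    using v by (auto simp: primitive_class_def)
  have \<Delta>h: "cocycle {b, a} m (\<Delta> t h)"
    using F h(1) by (intro T.\<Delta>_primitive_cocycle) (simp_all add: cocycle_UNIV)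
  show ?thesis
  proof
    assume "is_coboundary UNIV (Suc m) (const F)"
    then obtain z where z: "cocycle {b, a} m z" "\<And>gs. length gs = m \<Longrightarrow> \<Delta> t h gs = \<Delta> t z gs"
      using T.primitive_if_coboundary[OF h(1)] is_coboundary_UNIV by metis
    then have "ev (\<Delta> t h) = ev (\<Delta> t z)"
      using ev_cong[OF T.cocycle_\<Delta>[OF z(1)], of "\<Delta> t h"] by simp
    then show "v \<in> range M" using h(2) ev_\<Delta>[OF z(1)] by simp
  next
    assume "v \<in> range M"
    then obtain w where w: "v = M w" by blast
    obtain z where z: "cocycle {b, a} m z" "ev z = w" using ev_onto by blast
    have "ev (\<lambda>gs x. \<Delta> t h gs x - \<Delta> t z gs x) = 0"
      using h(2) ev_\<Delta>[OF z(1)] z(2) w by (simp add: ev_diff)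
    then have "is_coboundary {b, a} m (\<lambda>gs x. \<Delta> t h gs x - \<Delta> t z gs x)"
      using ev_eq_0_iff[OF cocycle_diff[OF \<Delta>h T.cocycle_\<Delta>[OF z(1)]]] by simp
    with h(1) z(1) show "is_coboundary UNIV (Suc m) (const F)"
      unfolding is_coboundary_UNIV by (rule T.coboundary_if_primitive)
  qed
qed

end

section \<open>The cohomology groups in all degrees other than 1\<close>

context torus_bundle
begin

lemma fibre_class_1:
  "fibre_class \<theta> \<alpha> \<beta> \<gamma> \<delta> (Suc 0) ev1 (\<lambda>(p, q). ((\<alpha> - 1) * p + \<beta> * q, \<gamma> * p + (\<delta> - 1) * q))"
proof unfold_locales
  fix F assume "cocycle {b, a} (Suc 0) F"
  then show "ev1 (\<Delta> t F) = (\<lambda>(p, q). ((\<alpha> - 1) * p + \<beta> * q, \<gamma> * p + (\<delta> - 1) * q)) (ev1 F)"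
    using ev1_\<Delta> by (cases "ev1 F") auto
qed (auto simp: ev1_diff H1_ba intro: cocycle_lin_cocycle ev1_lin_cocycle)

lemma fibre_class_2: "fibre_class \<theta> \<alpha> \<beta> \<gamma> \<delta> (Suc (Suc 0)) ev2 (\<lambda>c. (det \<theta> - 1) * c)"
proof unfold_locales
  fix c :: int
  have "ev2 (\<lambda>gs x. c * area_cocycle gs x) = c * ev2 area_cocycle"
    by (simp add: ev2_def algebra_simps)
  then show "\<exists>F. cocycle {b, a} (Suc (Suc 0)) F \<and> ev2 F = c"
    using cocycle_scale[OF cocycle_area_cocycle] ev2_area_cocycle by auto
qed (auto simp: ev2_diff H2_ba ev2_\<Delta>)

text \<open>Degree 3 over \<open>Inv {b, a}\<close> vanishes, so every class comes from the
  connecting map and the group is the cokernel of \<open>det \<theta> - 1\<close>. For determinant 1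
  the modulus is 0, which stands for the integers.\<close>

lemma H3: "integral_cohomology G (Suc (Suc (Suc 0))) \<cong> integer_mod_group (nat \<bar>det \<theta> - 1\<bar>)"
proof -
  interpret fibre_class \<theta> \<alpha> \<beta> \<gamma> \<delta> "Suc (Suc 0)" ev2 "\<lambda>c. (det \<theta> - 1) * c"
    by (rule fibre_class_2)
  let ?n = "nat \<bar>det \<theta> - 1\<bar>"
  show ?thesis
  proof (rule integral_cohomology_iso_rel[of _ "\<lambda>v. v mod int ?n" _ primitive_class])
    show "range (\<lambda>v. v mod int ?n) = carrier (integer_mod_group ?n)"
      by (rule range_mod)
    show "\<exists>v. primitive_class F v" if "cocycle UNIV (Suc (Suc (Suc 0))) (const F)" for F
      using that by (intro primitive_class_total H_ba_trivial cocycle_ba)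
    show "v mod int ?n = \<one>\<^bsub>integer_mod_group ?n\<^esub> \<longleftrightarrow>
        is_coboundary UNIV (Suc (Suc (Suc 0))) (const F)"
      if "cocycle UNIV (Suc (Suc (Suc 0))) (const F)" "primitive_class F v" for F v
    proof -
      have "v \<in> range (\<lambda>c. (det \<theta> - 1) * c) \<longleftrightarrow> det \<theta> - 1 dvd v" by (auto simp: dvd_def)
      then show ?thesis
        by (simp add: primitive_class_kernel[OF that] flip: dvd_eq_mod_eq_0)
    qed
  qed (auto simp: mod_add_eq intro: primitive_class_onto primitive_class_diff)
qed

lemma Hn_trivial: "n \<ge> 4 \<Longrightarrow> trivial_group (integral_cohomology G n)"
proof -
  assume "n \<ge> 4"
  then obtain k where n: "n = Suc (Suc (Suc (Suc k)))"
    using le_Suc_ex[of 4 n] by (auto simp: eval_nat_numeral)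
  show ?thesis
    unfolding n
    by (rule trivial_integral_cohomology) (simp add: cocycle_UNIV is_coboundary_UNIV H_tba_trivial)
qed

lemma H0: "integral_cohomology G 0 \<cong> integer_group"
proof (rule integral_cohomology_iso(2)[of _ _ "\<lambda>F. F []"])
  show "\<exists>F. cocycle UNIV 0 (const F) \<and> F [] = y" for y
    by (auto simp: cocycle_def cochain_const cobd_def length_Suc_conv intro!: exI[of _ "\<lambda>_. y"])
qed (auto simp: is_coboundary_0 fun_eq_iff)

text \<open>Multiplication by \<open>det \<theta> - 1 = -2\<close> is injective. An integral
  2-cocycle, being fixed by \<open>t\<close>, therefore has \<open>ev2\<close> zero and becomes
  trivial over \<open>Inv {b, a}\<close>, so only the cokernel part remains.\<close>

lemma H2_det_minus_1:
  assumes det: "det \<theta> = -1"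
    and u: "u11 * u22 - u12 * u21 = 1"
    and kernel: "\<And>v. residues2 u11 u12 u21 u22 c1 c2 v = \<one>\<^bsub>integer_mod_group c1 \<times>\<times> integer_mod_group c2\<^esub> \<longleftrightarrow>
      v \<in> range (\<lambda>(p, q). ((\<alpha> - 1) * p + \<beta> * q, \<gamma> * p + (\<delta> - 1) * q))"
  shows "integral_cohomology G (Suc (Suc 0)) \<cong> integer_mod_group c1 \<times>\<times> integer_mod_group c2"
proof -
  interpret fibre_class \<theta> \<alpha> \<beta> \<gamma> \<delta> "Suc 0" ev1
    "\<lambda>(p, q). ((\<alpha> - 1) * p + \<beta> * q, \<gamma> * p + (\<delta> - 1) * q)"
    by (rule fibre_class_1)
  let ?A = "integer_mod_group c1 \<times>\<times> integer_mod_group c2"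
  let ?\<kappa> = "residues2 u11 u12 u21 u22 c1 c2"
  show ?thesis
  proof (rule integral_cohomology_iso_rel[of _ ?\<kappa> _ primitive_class])
    show "\<exists>v. primitive_class F v" if F: "cocycle UNIV (Suc (Suc 0)) (const F)" for F
    proof (rule primitive_class_total)
      have "ev2 (\<Delta> t (const F)) = (det \<theta> - 1) * ev2 (const F)"
        by (intro ev2_\<Delta> cocycle_ba F)
      then have "ev2 (const F) = 0" unfolding \<Delta>_const by (simp add: ev2_def det)
      then show "is_coboundary {b, a} (Suc (Suc 0)) (const F)"
        using H2_ba cocycle_ba[OF F] by blast
    qed
    show "?\<kappa> v = \<one>\<^bsub>?A\<^esub> \<longleftrightarrow> is_coboundary UNIV (Suc (Suc 0)) (const F)"
      if "cocycle UNIV (Suc (Suc 0)) (const F)" "primitive_class F v" for F v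
      unfolding primitive_class_kernel[OF that] by (rule kernel)
    show "range ?\<kappa> = carrier ?A" by (rule range_residues2[OF u])
  qed (auto intro: DirProd_group primitive_class_onto primitive_class_diff simp: residues2_add)
qed

text \<open>Now \<open>t\<close> fixes the area class, and the group is an extension of the
  integers, via \<open>ev2\<close>, by the cokernel. An integral cocycle \<open>E\<close> with
  \<open>ev2\<close> equal to 1 splits it.\<close>

lemma H2_det_1:
  assumes det: "det \<theta> = 1"
    and u: "u11 * u22 - u12 * u21 = 1"
    and kernel: "\<And>v. residues2 u11 u12 u21 u22 c1 c2 v = \<one>\<^bsub>integer_mod_group c1 \<times>\<times> integer_mod_group c2\<^esub> \<longleftrightarrow>
      v \<in> range (\<lambda>(p, q). ((\<alpha> - 1) * p + \<beta> * q, \<gamma> * p + (\<delta> - 1) * q))"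
  shows "integral_cohomology G (Suc (Suc 0)) \<cong>
    integer_mod_group c1 \<times>\<times> integer_mod_group c2 \<times>\<times> integer_group"
proof -
  interpret fibre_class \<theta> \<alpha> \<beta> \<gamma> \<delta> "Suc 0" ev1
    "\<lambda>(p, q). ((\<alpha> - 1) * p + \<beta> * q, \<gamma> * p + (\<delta> - 1) * q)"
    by (rule fibre_class_1)
  let ?A = "integer_mod_group c1 \<times>\<times> integer_mod_group c2 \<times>\<times> integer_group"
  let ?r = "residues2 u11 u12 u21 u22 c1 c2"
  let ?\<kappa> = "\<lambda>(v, c). (fst (?r v), snd (?r v), c)"
  \<comment> \<open>The area class is fixed by \<open>t\<close>, so
    \<open>invariant_class_lifts\<close> turns it into a cocycle invariant under all generators, the
    source of \<open>E\<close>.\<close>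
  have "ev2 (\<Delta> t area_cocycle) = 0"
    by (simp add: ev2_\<Delta>[OF cocycle_area_cocycle] det)
  then have "is_coboundary {b, a} (Suc (Suc 0)) (\<Delta> t area_cocycle)"
    using H2_ba[OF T.cocycle_\<Delta>[OF cocycle_area_cocycle]] by blast
  then obtain z where z: "cocycle {t, b, a} (Suc (Suc 0)) z"
    "is_coboundary {b, a} (Suc (Suc 0)) (\<lambda>gs x. area_cocycle gs x - z gs x)"
    using T.invariant_class_lifts[OF cocycle_area_cocycle] by blast
  obtain E where E: "cocycle UNIV (Suc (Suc 0)) (const E)"
    "\<And>gs. length gs = Suc (Suc 0) \<Longrightarrow> const E gs = z gs"
    using const_representative z(1) cocycle_UNIV by metis
  have "ev2 (const E) = ev2 z"
    using E(2)[of "[a, b]"] E(2)[of "[b, a]"] by (simp add: ev2_def fun_eq_iff del: split_paired_All)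
  moreover have "ev2 (\<lambda>gs x. area_cocycle gs x - z gs x) = 0"
    using z H2_ba[OF cocycle_diff[OF cocycle_area_cocycle cocycle_mono[OF _ z(1)]]] by blast
  ultimately have ev2_E: "ev2 (const E) = 1"
    by (simp add: ev2_diff ev2_area_cocycle)
  have ev2_sub: "ev2 (const (\<lambda>gs. F gs - c * E gs)) = ev2 (const F) - c" for F c
    using ev2_E by (simp add: ev2_def algebra_simps)
  have cocycle_sub: "cocycle UNIV (Suc (Suc 0)) (const (\<lambda>gs. F gs - c * E gs))"
    if "cocycle UNIV (Suc (Suc 0)) (const F)" for F c
    by (rule cocycle_diff[OF that cocycle_scale[OF E(1)]])
  \<comment> \<open>The second component is the coordinate along \<open>E\<close>, the first the
    primitive class of what remains after removing that multiple of \<open>E\<close>.\<close>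
  define R where "R F w \<longleftrightarrow> snd w = ev2 (const F) \<and>
    primitive_class (\<lambda>gs. F gs - snd w * E gs) (fst w)" for F w
  show ?thesis
  proof (rule integral_cohomology_iso_rel[of _ ?\<kappa> _ R])
    show "group ?A" by (intro DirProd_group) simp_all
    show "?\<kappa> (v + w) = ?\<kappa> v \<otimes>\<^bsub>?A\<^esub> ?\<kappa> w" for v w
      by (cases v; cases w) (simp add: residues2_add mult_DirProd')
    show "range ?\<kappa> = carrier ?A"
    proof (intro equalityI subsetI)
      fix y :: "int \<times> int \<times> int" assume "y \<in> range ?\<kappa>"
      then obtain v c where "y = (fst (?r v), snd (?r v), c)" by auto
      moreover have "?r v \<in> carrier (integer_mod_group c1 \<times>\<times> integer_mod_group c2)"
        using range_residues2[OF u] by blast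
      ultimately show "y \<in> carrier ?A" by (cases "?r v") simp
    next
      fix y assume "y \<in> carrier ?A"
      then have "(fst y, fst (snd y)) \<in> range ?r"
        unfolding range_residues2[OF u] by auto
      then obtain v where "?r v = (fst y, fst (snd y))" by (metis imageE)
      then have "y = ?\<kappa> (v, snd (snd y))" by simp
      then show "y \<in> range ?\<kappa>" by (rule image_eqI) simp
    qed
    show "\<exists>w. R F w" if F: "cocycle UNIV (Suc (Suc 0)) (const F)" for F
    proof -
      have "cocycle {b, a} (Suc (Suc 0)) (const (\<lambda>gs. F gs - ev2 (const F) * E gs))"
        by (intro cocycle_ba cocycle_sub F)
      then have "is_coboundary {b, a} (Suc (Suc 0)) (const (\<lambda>gs. F gs - ev2 (const F) * E gs))"
        using H2_ba ev2_sub by simp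
      then obtain v where "primitive_class (\<lambda>gs. F gs - ev2 (const F) * E gs) v"
        using primitive_class_total[of "\<lambda>gs. F gs - ev2 (const F) * E gs"] by blast
      then show ?thesis by (intro exI[of _ "(v, ev2 (const F))"]) (simp add: R_def)
    qed
    show "\<exists>F. cocycle UNIV (Suc (Suc 0)) (const F) \<and> R F w" for w
    proof -
      obtain F where F: "cocycle UNIV (Suc (Suc 0)) (const F)" "primitive_class F (fst w)"
        using primitive_class_onto by blast
      have "is_coboundary {b, a} (Suc (Suc 0)) (const F)"
        using F(2) by (auto simp: primitive_class_def is_coboundary_Suc)
      then have "ev2 (const F) = 0" using H2_ba[OF cocycle_ba[OF F(1)]] by simp
      \<comment> \<open>Adding \<open>snd w\<close> copies of \<open>E\<close> moves
        \<open>ev2\<close> from 0 to \<open>snd w\<close> and leaves the remainder equal to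
        \<open>F\<close>.\<close>
      then have "R (\<lambda>gs. F gs - (- snd w) * E gs) w"
        unfolding R_def ev2_sub using F(2) by simp
      then show ?thesis
        using cocycle_sub[OF F(1), of "- snd w"]
        by (intro exI[of _ "\<lambda>gs. F gs - (- snd w) * E gs"] conjI)
    qed
    show "R (\<lambda>gs. F gs - F' gs) (w - w')" if "R F w" "R F' w'" for F F' w w'
    proof -
      have "primitive_class (\<lambda>gs. (F gs - snd w * E gs) - (F' gs - snd w' * E gs)) (fst w - fst w')"
        using that unfolding R_def by (intro primitive_class_diff) blast+
      also have "(\<lambda>gs. (F gs - snd w * E gs) - (F' gs - snd w' * E gs)) =
          (\<lambda>gs. (F gs - F' gs) - snd (w - w') * E gs)"
        by (simp add: algebra_simps)
      finally show ?thesis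
        using that by (simp add: R_def ev2_diff)
    qed
    show "?\<kappa> w = \<one>\<^bsub>?A\<^esub> \<longleftrightarrow> is_coboundary UNIV (Suc (Suc 0)) (const F)"
      if F: "cocycle UNIV (Suc (Suc 0)) (const F)" and w: "R F w" for F w
    proof -
      have "?\<kappa> w = \<one>\<^bsub>?A\<^esub> \<longleftrightarrow> snd w = 0 \<and> ?r (fst w) = \<one>\<^bsub>integer_mod_group c1 \<times>\<times> integer_mod_group c2\<^esub>"
        by (auto simp: prod_eq_iff split_beta)
      also have "\<dots> \<longleftrightarrow> is_coboundary UNIV (Suc (Suc 0)) (const F)"
      proof (cases "snd w = 0")
        case True
        then have "primitive_class F (fst w)" using w by (simp add: R_def)
        then show ?thesis using True kernel primitive_class_kernel[OF F] by simp
      next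
        case False
        then have "\<not> is_coboundary {b, a} (Suc (Suc 0)) (const F)"
          using w H2_ba[OF cocycle_ba[OF F]] by (simp add: R_def)
        then show ?thesis using False is_coboundary_ba by blast
      qed
      finally show ?thesis .
    qed
  qed
qed

end

section \<open>The rank of the matrix and the first cohomology group\<close>

lemma restrict_eq_zero_iff: "(\<lambda>i\<in>{..<n}. f i) = (\<lambda>i\<in>{..<n}. 0 :: int) \<longleftrightarrow> (\<forall>i<n. f i = 0)" for n :: nat
  by (auto simp: fun_eq_iff restrict_def split: if_splits)

lemma rank_2x2:
  fixes N :: "real^2^2"
  shows "rank N = (if N = 0 then 0 else if det N = 0 then 1 else 2)"
proof -
  have "rank N = 2 \<longleftrightarrow> det N \<noteq> 0"
    using full_rank_injective[of N] matrix_left_invertible_injective[of N]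
    by (simp add: invertible_det_nz[symmetric] invertible_left_inverse)
  moreover have "rank N \<le> 2" using rank_bound[of N] by simp
  moreover have "det N = 0" if "N = 0" using that by (simp add: det_2)
  ultimately show ?thesis using rank_eq_0[of N]
    by (cases "rank N = 0") auto
qed

context torus_bundle
begin

lemma cocycle_1_iff:
  "cocycle UNIV (Suc 0) (const F) \<longleftrightarrow> (\<forall>x y. F [x \<otimes>\<^bsub>G\<^esub> y] = F [x] + F [y])"
proof
  assume *: "cocycle UNIV (Suc 0) (const F)"
  show "\<forall>x y. F [x \<otimes>\<^bsub>G\<^esub> y] = F [x] + F [y]"
  proof (intro allI)
    fix x y
    have "cobd (const F) [x, y] \<one>\<^bsub>G\<^esub> = 0"
      using * unfolding cocycle_def by (simp del: split_paired_All)
    then show "F [x \<otimes>\<^bsub>G\<^esub> y] = F [x] + F [y]" by (simp add: cobd_def)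
  qed
next
  assume *: "\<forall>x y. F [x \<otimes>\<^bsub>G\<^esub> y] = F [x] + F [y]"
  have "cobd (const F) gs z = 0" if len: "length gs = Suc (Suc 0)" for gs z
  proof -
    obtain v k w l where "gs = [(v, k), (w, l)]" using len by (auto simp: length_Suc_conv)
    then show ?thesis using *[rule_format, of "(v, k)" "(w, l)"] by (simp add: cobd_def)
  qed
  then show "cocycle UNIV (Suc 0) (const F)"
    by (simp add: cocycle_def cochain_const)
qed

text \<open>A class is a homomorphism to the integers, given by its values at \<open>a\<close>,
  \<open>b\<close> and \<open>t\<close>. The value at \<open>t\<close> is free, while the other two
  must form a vector fixed by the transpose of \<open>\<theta>\<close>; in the coordinates given by
  \<open>v\<close> such vectors form a coordinate subspace.\<close>

lemma H1:
  assumes v: "v11 * v22 - v12 * v21 = 1"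
    and kernel: "\<And>x y. (\<alpha> - 1) * (v11 * x + v12 * y) + \<beta> * (v21 * x + v22 * y) = 0 \<and>
        \<gamma> * (v11 * x + v12 * y) + (\<delta> - 1) * (v21 * x + v22 * y) = 0 \<longleftrightarrow>
      (c1 = (0::nat) \<or> x = 0) \<and> (c2 = (0::nat) \<or> y = 0)"
    and r: "r = (if c1 = 0 then 0 else if c2 = 0 then 1 else (2 :: nat))"
    and "c1 dvd c2"
  shows "integral_cohomology G (Suc 0) \<cong> product_group {..<3 - r} (\<lambda>_. integer_group)"
proof -
  define w1 where "w1 F = v22 * F [a] - v12 * F [b]" for F :: "((int \<times> int) \<times> int) list \<Rightarrow> int"
  define w2 where "w2 F = v11 * F [b] - v21 * F [a]" for F :: "((int \<times> int) \<times> int) list \<Rightarrow> int"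
  have Fa: "F [a] = v11 * w1 F + v12 * w2 F" and Fb: "F [b] = v21 * w1 F + v22 * w2 F" for F
    unfolding w1_def w2_def using v by algebra+
  \<comment> \<open>The order puts coordinates that may be forced to vanish last: \<open>w1\<close>
    is zero unless \<open>c1 = 0\<close>, \<open>w2\<close> unless \<open>c2 = 0\<close>, and
    \<open>c1 = 0\<close> implies \<open>c2 = 0\<close>. Hence the first \<open>3 - r\<close>
    entries are exactly the free ones.\<close>
  define \<epsilon> where "\<epsilon> F = (\<lambda>i\<in>{..<3 - r}. [F [t], w2 F, w1 F] ! i)" for F
  let ?A = "product_group {..<3 - r} (\<lambda>_. integer_group)"
  have less_3: "i < 3 \<longleftrightarrow> i = 0 \<or> i = 1 \<or> i = 2" for i :: nat by auto
  have c: "c1 = 0 \<Longrightarrow> c2 = 0" using \<open>c1 dvd c2\<close> by simp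
  have w_zero: "(c1 = 0 \<or> w1 F = 0) \<and> (c2 = 0 \<or> w2 F = 0)"
    if F: "cocycle UNIV (Suc 0) (const F)" for F
  proof -
    have "ev1 (\<Delta> t (const F)) = ((\<alpha> - 1) * F [a] + \<beta> * F [b], \<gamma> * F [a] + (\<delta> - 1) * F [b])"
      by (rule ev1_\<Delta>[OF cocycle_ba[OF F]]) (simp add: ev1_def)
    then have "(\<alpha> - 1) * F [a] + \<beta> * F [b] = 0 \<and> \<gamma> * F [a] + (\<delta> - 1) * F [b] = 0"
      unfolding \<Delta>_const by (simp add: ev1_def)
    then show ?thesis using kernel[of "w1 F" "w2 F"] by (simp add: Fa Fb)
  qed
  show ?thesis
  proof (rule integral_cohomology_iso(2)[of ?A _ \<epsilon>])
    show "group ?A" by simp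
    show "\<epsilon> F \<in> carrier ?A" for F by (simp add: \<epsilon>_def)
    show "\<epsilon> F'' = \<epsilon> F \<otimes>\<^bsub>?A\<^esub> \<epsilon> F'" if "\<And>gs. length gs = Suc 0 \<Longrightarrow> F'' gs = F gs + F' gs" for F F' F''
    proof -
      have "[F'' [t], w2 F'', w1 F''] ! i = [F [t], w2 F, w1 F] ! i + [F' [t], w2 F', w1 F'] ! i"
        if "i < 3 - r" for i
        using that \<open>\<And>gs. length gs = Suc 0 \<Longrightarrow> F'' gs = F gs + F' gs\<close> less_3[of i]
        by (auto simp: w1_def w2_def algebra_simps)
      then show ?thesis by (auto simp: \<epsilon>_def fun_eq_iff)
    qed
    show "\<exists>F. cocycle UNIV (Suc 0) (const F) \<and> \<epsilon> F = y" if y: "y \<in> carrier ?A" for y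
    proof -
      define x1 where "x1 = (if c1 = 0 then y 2 else 0)"
      define x2 where "x2 = (if c2 = 0 then y 1 else 0)"
      define p where "p = v11 * x1 + v12 * x2"
      define q where "q = v21 * x1 + v22 * x2"
      \<comment> \<open>Linear in all three coordinates. It is a homomorphism because the functional
        \<open>(p, q)\<close> is unchanged by \<open>\<theta>\<close>, hence by every
        \<open>pw k\<close>.\<close>
      define F where "F gs = p * fst (fst (hd gs)) + q * snd (fst (hd gs)) + y 0 * snd (hd gs)"
        for gs :: "((int \<times> int) \<times> int) list"
      have pq: "(\<alpha> - 1) * p + \<beta> * q = 0" "\<gamma> * p + (\<delta> - 1) * q = 0"
        using kernel[of x1 x2] by (auto simp: x1_def x2_def p_def q_def)
      have "p * fst (pw 1 w) + q * snd (pw 1 w) = p * fst w + q * snd w" for w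
      proof -
        have "p * (\<alpha> * fst w + \<gamma> * snd w) + q * (\<beta> * fst w + \<delta> * snd w) - (p * fst w + q * snd w)
          = ((\<alpha> - 1) * p + \<beta> * q) * fst w + (\<gamma> * p + (\<delta> - 1) * q) * snd w"
          by (simp add: algebra_simps)
        then show ?thesis unfolding pq by (cases w) (simp add: pw_1)
      qed
      then have "p * fst (pw (1 + k) w) + q * snd (pw (1 + k) w) = p * fst (pw k w) + q * snd (pw k w)" for k w
        by (simp add: pw_plus)
      then have inv: "p * fst (pw k w) + q * snd (pw k w) = p * fst w + q * snd w" for k w
        using int_shift_invariant[of "\<lambda>k. p * fst (pw k w) + q * snd (pw k w)" k] by simp
      have "F [x \<otimes>\<^bsub>G\<^esub> z] = F [x] + F [z]" for x z
        using inv[of "snd x" "fst z"] by (cases x; cases z) (simp add: F_def algebra_simps)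
      then have "cocycle UNIV (Suc 0) (const F)" by (simp add: cocycle_1_iff del: split_paired_All)
      moreover have F_values: "F [a] = p" "F [b] = q" "F [t] = y 0"
        by (simp_all add: F_def a_def b_def t_def)
      have "w1 F = (v11 * v22 - v12 * v21) * x1" "w2 F = (v11 * v22 - v12 * v21) * x2"
        unfolding w1_def w2_def F_values p_def q_def by (simp_all add: algebra_simps)
      then have "w1 F = x1" "w2 F = x2" using v by simp_all
      have "\<epsilon> F i = y i" for i
      proof (cases "i < 3 - r")
        case True
        then have "i = 0 \<or> i = 1 \<and> c2 = 0 \<or> i = 2 \<and> c1 = 0 \<and> c2 = 0"
          using c by (auto simp: r split: if_splits)
        then show ?thesis
          using True \<open>w1 F = x1\<close> \<open>w2 F = x2\<close> F_values by (auto simp: \<epsilon>_def x1_def x2_def)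
      next
        case False
        then show ?thesis using y by (auto simp: \<epsilon>_def PiE_def extensional_def)
      qed
      then have "\<epsilon> F = y" by blast
      ultimately show ?thesis by blast
    qed
    show "\<epsilon> F = \<one>\<^bsub>?A\<^esub> \<longleftrightarrow> is_coboundary UNIV (Suc 0) (const F)"
      if F: "cocycle UNIV (Suc 0) (const F)" for F
    proof -
      have "\<epsilon> F = \<one>\<^bsub>?A\<^esub> \<longleftrightarrow> (\<forall>i<3 - r. [F [t], w2 F, w1 F] ! i = 0)"
        by (simp add: \<epsilon>_def restrict_eq_zero_iff)
      also have "\<dots> \<longleftrightarrow> F [t] = 0 \<and> w1 F = 0 \<and> w2 F = 0"
        using w_zero[OF F] c by (auto simp: r numeral_3_eq_3 numeral_2_eq_2 All_less_Suc2)
      also have "\<dots> \<longleftrightarrow> F [t] = 0 \<and> F [a] = 0 \<and> F [b] = 0"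
      proof -
        have "F [a] = 0 \<and> F [b] = 0" if "w1 F = 0" "w2 F = 0" using that by (simp add: Fa Fb)
        moreover have "w1 F = 0 \<and> w2 F = 0" if "F [a] = 0" "F [b] = 0"
          using that by (simp add: w1_def w2_def)
        ultimately show ?thesis by blast
      qed
      also have "\<dots> \<longleftrightarrow> is_coboundary UNIV (Suc 0) (const F)"
      proof
        assume zero: "F [t] = 0 \<and> F [a] = 0 \<and> F [b] = 0"
        then have "ev1 (const F) = 0" by (simp add: ev1_def zero_prod_def)
        then have "is_coboundary {b, a} (Suc 0) (const F)" using H1_ba[OF cocycle_ba[OF F]] by simp
        then show "is_coboundary UNIV (Suc 0) (const F)"
          using F zero T.coboundary_1_step unfolding cocycle_UNIV is_coboundary_UNIV by blast
      next
        assume "is_coboundary UNIV (Suc 0) (const F)"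
        from coboundary_1_eval[OF this UNIV_I] show "F [t] = 0 \<and> F [a] = 0 \<and> F [b] = 0"
          by (simp del: split_paired_All)
      qed
      finally show ?thesis .
    qed
  qed
qed

end

section \<open>From elementary divisors to the cases by rank and determinant\<close>

theorem theorem3:
  fixes \<alpha> \<beta> \<gamma> \<delta> :: int and \<theta> :: "int^2^2"
  assumes theta: "\<theta> = vector [vector [\<alpha>, \<gamma>], vector [\<beta>, \<delta>]]"
    and GL2: "invertible \<theta>"
  shows "let
      H = integral_cohomology (torus_bundle_group \<theta>);
      r = rank (map_matrix real_of_int (\<theta> - mat 1));
      Z = integer_group;
      Zmod = integer_mod_group
    in
      H 0 \<cong> Z
    \<and> H 1 \<cong> product_group {..<3 - r} (\<lambda>_. Z)
    \<and> (r = 0 \<longrightarrow> H 2 \<cong> Z \<times>\<times> Z \<times>\<times> Z)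
    \<and> (r = 1 \<and> det \<theta> = 1 \<longrightarrow> H 2 \<cong> Zmod (nat (gcd \<beta> \<gamma>)) \<times>\<times> Z \<times>\<times> Z)
    \<and> (r = 1 \<and> det \<theta> = -1 \<longrightarrow> H 2 \<cong> Zmod (nat (gcd (gcd \<beta> \<gamma>) 2)) \<times>\<times> Z)
    \<and> (r = 2 \<longrightarrow> (\<exists>c1 c2 :: nat. 0 < c1 \<and> 0 < c2 \<and> c1 dvd c2
          \<and> int (c1 * c2) = \<bar>det (\<theta> - mat 1)\<bar>
          \<and> (det \<theta> = 1 \<longrightarrow> H 2 \<cong> Zmod c1 \<times>\<times> Zmod c2 \<times>\<times> Z)
          \<and> (det \<theta> = -1 \<longrightarrow> H 2 \<cong> Zmod c1 \<times>\<times> Zmod c2)))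
    \<and> (det \<theta> = 1 \<longrightarrow> H 3 \<cong> Z)
    \<and> (det \<theta> = -1 \<longrightarrow> H 3 \<cong> Zmod 2)
    \<and> (\<forall>n\<ge>4. trivial_group (H n))"
proof -
  interpret torus_bundle \<theta> \<alpha> \<beta> \<gamma> \<delta> by unfold_locales (fact theta GL2)+
  \<comment> \<open>The normal form is that of the transpose of \<open>\<theta>\<close> minus the
    identity, with rows \<open>(\<alpha> - 1, \<beta>)\<close> and
    \<open>(\<gamma>, \<delta> - 1)\<close>. Its divisors give the rank too: \<open>c1\<close>
    vanishes with all entries, \<open>c1 * c2\<close> with the determinant.\<close>
  obtain u11 u22 u12 u21 v11 v22 v12 v21 :: int and c1 c2 :: nat
    where u: "u11 * u22 - u12 * u21 = 1" and v: "v11 * v22 - v12 * v21 = 1" and c: "c1 dvd c2"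
      and c1c2: "int (c1 * c2) = \<bar>(\<alpha> - 1) * (\<delta> - 1) - \<beta> * \<gamma>\<bar>"
      and c1: "int c1 = gcd (gcd (\<alpha> - 1) \<beta>) (gcd \<gamma> (\<delta> - 1))"
      and image: "\<And>i j. (\<exists>x y. (\<alpha> - 1) * x + \<beta> * y = i \<and> \<gamma> * x + (\<delta> - 1) * y = j) \<longleftrightarrow>
        int c1 dvd u11 * i + u12 * j \<and> int c2 dvd u21 * i + u22 * j"
      and kernel: "\<And>x y. (\<alpha> - 1) * (v11 * x + v12 * y) + \<beta> * (v21 * x + v22 * y) = 0 \<and>
          \<gamma> * (v11 * x + v12 * y) + (\<delta> - 1) * (v21 * x + v22 * y) = 0 \<longleftrightarrow>
        (c1 = 0 \<or> x = 0) \<and> (c2 = 0 \<or> y = 0)"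
    by (fact smith_normal_form[of "\<alpha> - 1" "\<delta> - 1" \<beta> \<gamma>])
  define r where "r = rank (map_matrix real_of_int (\<theta> - mat 1))"
  have det_minus: "det (\<theta> - mat 1) = (\<alpha> - 1) * (\<delta> - 1) - \<beta> * \<gamma>"
    by (simp add: det_2 entries mat_def)
  have r: "r = (if c1 = 0 then 0 else if c2 = 0 then 1 else 2)"
  proof -
    let ?N = "map_matrix real_of_int (\<theta> - mat 1)"
    have "?N = 0 \<longleftrightarrow> \<alpha> - 1 = 0 \<and> \<beta> = 0 \<and> \<gamma> = 0 \<and> \<delta> - 1 = 0"
      by (auto simp: vec_eq_iff forall_2 entries mat_def)
    also have "\<dots> \<longleftrightarrow> int c1 = 0" unfolding c1 by auto
    finally have "?N = 0 \<longleftrightarrow> c1 = 0" by simp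
    moreover have "det ?N = real_of_int (det (\<theta> - mat 1))" by (simp add: det_2)
    then have "det ?N = 0 \<longleftrightarrow> int (c1 * c2) = 0"
      unfolding c1c2 det_minus by (simp only: of_int_eq_0_iff abs_eq_0)
    ultimately show ?thesis unfolding r_def by (auto simp: rank_2x2)
  qed
  have coker: "residues2 u11 u12 u21 u22 c1 c2 w = \<one>\<^bsub>integer_mod_group c1 \<times>\<times> integer_mod_group c2\<^esub> \<longleftrightarrow>
      w \<in> range (\<lambda>(p, q). ((\<alpha> - 1) * p + \<beta> * q, \<gamma> * p + (\<delta> - 1) * q))" for w
  proof -
    have "w \<in> range (\<lambda>(p, q). ((\<alpha> - 1) * p + \<beta> * q, \<gamma> * p + (\<delta> - 1) * q)) \<longleftrightarrow>
      (\<exists>x y. (\<alpha> - 1) * x + \<beta> * y = fst w \<and> \<gamma> * x + (\<delta> - 1) * y = snd w)"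
      by (cases w) (auto simp: image_iff)
    then show ?thesis
      unfolding image by (cases w) (simp add: residues2_def dvd_eq_mod_eq_0)
  qed
  have H2_plus: "integral_cohomology G 2 \<cong> integer_mod_group c1 \<times>\<times> integer_mod_group c2 \<times>\<times> integer_group"
    if "det \<theta> = 1"
    using H2_det_1[OF that u coker] by (simp add: numeral_2_eq_2)
  have H2_minus: "integral_cohomology G 2 \<cong> integer_mod_group c1 \<times>\<times> integer_mod_group c2"
    if "det \<theta> = -1"
    using H2_det_minus_1[OF that u coker] by (simp add: numeral_2_eq_2)
  \<comment> \<open>In rank 0 the greatest common divisor of the entries is 0, so
    \<open>\<theta>\<close> is the identity matrix.\<close>
  have rank_0: "det \<theta> = 1" if "r = 0"
  proof -
    have "int c1 = 0" using that by (simp add: r split: if_splits)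
    then show ?thesis unfolding c1 by (simp add: det_theta)
  qed
  have rank_1: "c2 = 0" "(\<alpha> - 1) * (\<delta> - 1) = \<beta> * \<gamma>" if "r = 1"
    using that c1c2 by (auto simp: r split: if_splits)
  \<comment> \<open>Determinant 1 and eigenvalue 1 force trace 2, so the diagonal entries of
    \<open>\<theta> - mat 1\<close> are opposite and the square of \<open>\<alpha> - 1\<close>
    equals \<open>- \<beta> * \<gamma>\<close>. Comparing squares,
    \<open>gcd \<beta> \<gamma>\<close> divides the diagonal as well.\<close>
  have c1_plus: "c1 = nat (gcd \<beta> \<gamma>)" if "r = 1" "det \<theta> = 1"
  proof -
    have sum: "\<delta> - 1 = - (\<alpha> - 1)"
      using rank_1(2)[OF that(1)] that(2) by (simp add: det_theta algebra_simps)
    have "(gcd \<beta> \<gamma>)\<^sup>2 dvd \<beta> * \<gamma>" unfolding power2_eq_square by (intro mult_dvd_mono) auto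
    also have "\<beta> * \<gamma> = - (\<alpha> - 1)\<^sup>2"
      using rank_1(2)[OF that(1)] unfolding sum by (simp add: power2_eq_square algebra_simps)
    finally have "(gcd \<beta> \<gamma>)\<^sup>2 dvd (\<alpha> - 1)\<^sup>2" by (simp only: dvd_minus_iff)
    then have "gcd \<beta> \<gamma> dvd \<alpha> - 1" by simp
    moreover from this have "gcd \<beta> \<gamma> dvd 1 - \<alpha>" by (metis dvd_minus_iff minus_diff_eq)
    ultimately have "int c1 = gcd \<beta> \<gamma>"
      unfolding c1 sum by (intro zdvd_antisym_nonneg) (auto intro: dvd_trans[OF gcd_dvd1] dvd_trans[OF gcd_dvd2])
    then show ?thesis by simp
  qed
  \<comment> \<open>Determinant -1 and eigenvalue 1 force trace 0, so the diagonal entries of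
    \<open>\<theta> - mat 1\<close> add up to -2 and \<open>c1\<close> divides 2. Conversely, if
    \<open>\<beta>\<close> and \<open>\<gamma>\<close> are even, then
    \<open>(\<alpha> - 1) * (\<delta> - 1) = \<beta> * \<gamma>\<close> makes
    \<open>\<alpha>\<close> odd and the diagonal even.\<close>
  have c1_minus: "c1 = nat (gcd (gcd \<beta> \<gamma>) 2)" if "r = 1" "det \<theta> = -1"
  proof -
    have sum: "\<delta> = - \<alpha>"
      using rank_1(2)[OF that(1)] that(2) by (simp add: det_theta algebra_simps)
    let ?g = "gcd (gcd \<beta> \<gamma>) 2"
    have "?g dvd \<alpha> - 1"
    proof (cases "even \<beta> \<and> even \<gamma>")
      case True
      have "even (\<beta> * \<gamma>)" using True by simp
      then have "odd \<alpha>" unfolding rank_1(2)[OF that(1), symmetric] sum by simp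
      then have "2 dvd \<alpha> - 1" by simp
      then show ?thesis by (rule dvd_trans[OF gcd_dvd2])
    next
      case False
      then have "?g = 1"
        by (auto simp: gcd.commute[of _ 2] coprime_iff_gcd_eq_1[symmetric] coprime_left_2_iff_odd)
      then show ?thesis by simp
    qed
    moreover have "gcd (gcd (\<alpha> - 1) \<beta>) (gcd \<gamma> (\<delta> - 1)) dvd 2"
    proof -
      have "gcd (gcd (\<alpha> - 1) \<beta>) (gcd \<gamma> (\<delta> - 1)) dvd - ((\<alpha> - 1) + (\<delta> - 1))"
        unfolding dvd_minus_iff
        by (intro dvd_add) (auto intro: dvd_trans[OF gcd_dvd1] dvd_trans[OF gcd_dvd2])
      then show ?thesis by (simp add: sum)
    qed
    moreover have "?g dvd \<delta> - 1"
    proof -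
      have "?g dvd - ((\<alpha> - 1) + 2)"
        unfolding dvd_minus_iff using \<open>?g dvd \<alpha> - 1\<close> by (intro dvd_add) auto
      also have "- ((\<alpha> - 1) + 2) = \<delta> - 1" by (simp add: sum)
      finally show ?thesis .
    qed
    ultimately have "int c1 = ?g"
      unfolding c1 by (intro zdvd_antisym_nonneg)
        (auto intro: dvd_trans[OF gcd_dvd1] dvd_trans[OF gcd_dvd2])
    then show ?thesis by simp
  qed
  have "integral_cohomology G 1 \<cong> product_group {..<3 - r} (\<lambda>_. integer_group)"
    using H1[OF v kernel r c] by simp
  moreover have "integral_cohomology G 2 \<cong> integer_group \<times>\<times> integer_group \<times>\<times> integer_group" if "r = 0"
    using H2_plus[OF rank_0[OF that]] that c by (simp add: r integer_mod_group_zero split: if_splits)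
  moreover have "\<exists>c1 c2 :: nat. 0 < c1 \<and> 0 < c2 \<and> c1 dvd c2 \<and> int (c1 * c2) = \<bar>det (\<theta> - mat 1)\<bar>
      \<and> (det \<theta> = 1 \<longrightarrow> integral_cohomology G 2 \<cong>
          integer_mod_group c1 \<times>\<times> integer_mod_group c2 \<times>\<times> integer_group)
      \<and> (det \<theta> = -1 \<longrightarrow> integral_cohomology G 2 \<cong> integer_mod_group c1 \<times>\<times> integer_mod_group c2)"
    if "r = 2"
    using that c c1c2 H2_plus H2_minus unfolding det_minus
    by (intro exI[of _ c1] exI[of _ c2]) (auto simp: r split: if_splits)
  moreover have "integral_cohomology G 2 \<cong> integer_mod_group (nat (gcd \<beta> \<gamma>)) \<times>\<times> integer_group \<times>\<times> integer_group"
    if "r = 1" "det \<theta> = 1"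
    using H2_plus[OF that(2)] unfolding rank_1(1)[OF that(1)] c1_plus[OF that] integer_mod_group_zero .
  moreover have "integral_cohomology G 2 \<cong> integer_mod_group (nat (gcd (gcd \<beta> \<gamma>) 2)) \<times>\<times> integer_group"
    if "r = 1" "det \<theta> = -1"
    using H2_minus[OF that(2)] unfolding rank_1(1)[OF that(1)] c1_minus[OF that] integer_mod_group_zero .
  moreover have "integral_cohomology G 3 \<cong> integer_group" if "det \<theta> = 1"
    using H3 that by (simp add: numeral_3_eq_3 integer_mod_group_zero)
  moreover have "integral_cohomology G 3 \<cong> integer_mod_group 2" if "det \<theta> = -1"
    using H3 that by (simp add: numeral_3_eq_3)
  ultimately show ?thesis
    unfolding Let_def r_def[symmetric] using H0 Hn_trivial by blast
qed

end
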